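(* For every $1\le\alpha\le N$ and every symmetric rational function $P(x_1,\dots,x_\alpha)\in\mathcal F_\alpha$, $$\mathcal M_\alpha(P)=\mathcal D_\alpha(P),$$ that is, $$\frac1{\alpha!}\,CT_{\mathbf u}\Big(P(u_1^{-1},\dots,u_\alpha^{-1})\prod_{1\le i<j\le\alpha}\frac{(u_i-u_j)(u_i-qu_j)}{(u_i-tu_j)(tu_i-qu_j)}\prod_{i=1}^\alpha\mathfrak m(u_i)\Big)$$ $$=\frac1{\alpha!\,(N-\alpha)!}\,\mathrm{Sym}\Big(P(x_1,\dots,x_\alpha)\prod_{1\le i\le\alpha<j\le N}\frac{tx_i-x_j}{x_i-x_j}\,\Gamma_1\Gamma_2\cdots\Gamma_\alpha\Big).$$
   Context: $q,t$ are indeterminates; $\mathcal F_\alpha=\mathbb C(q,t)(x_1,\dots,x_\alpha)^{S_\alpha}$. Operators act on $\mathcal F_N$; $\Gamma_i$ is the shift $x_i\mapsto qx_i$. $\mathrm{Sym}$ is the sum over all permutations of the indices $1,\dots,N$ (of both the variables $x_i$ and the shifts $\Gamma_i$). The right side defines the generalized Macdonald operator $\mathcal D_\alpha(P)$ and the left side defines $\mathcal M_\alpha(P)$. The current $\mathfrak m$ is $$\mathfrak m(u)=\sum_{n\in\mathbb Z}u^n\sum_{i=1}^Nx_i^n\prod_{j\ne i}\frac{tx_i-x_j}{x_i-x_j}\,\Gamma_i=\sum_{i=1}^N\delta(ux_i)\prod_{j\neq i}\frac{tx_i-x_j}{x_i-x_j}\,\Gamma_i,\qquad \delta(u)=\sum_{n\in\mathbb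 Z}u^n .$$ The product $\prod_{i=1}^\alpha\mathfrak m(u_i)=\mathfrak m(u_1)\mathfrak m(u_2)\cdots\mathfrak m(u_\alpha)$ is ordered. $CT_{\mathbf u}=CT_{u_1,\dots,u_\alpha}$ is the multiple constant term (coefficient of $u_1^0\cdots u_\alpha^0$), with the convention $CT_v(f(v)\delta(u/v))=f(u)$. Convention for rational functions multiplying currents: $\mathfrak m(u_1)\cdots\mathfrak m(u_\alpha)$ is a finite sum of terms $c\,\prod_k\delta(u_ky_k)\,\Gamma$, where each $y_k$ is a power of $q$ times one of the variables $x_i$, $c$ is a rational function of the $x_i$ and $\Gamma$ is a product of shifts. A rational function $R(\mathbf u)$ regular at $u_k=y_k^{-1}$ multiplies such a term by $R(\mathbf u)\prod_k\delta(u_ky_k)=R(y_1^{-1},\dots,y_\alpha^{-1})\prod_k\delta(u_ky_k)$. In the definition of $\mathcal M_\alpha(P)$ the product $\prod_{i<j}\frac{(u_i-u_j)(u_i-qu_j)}{(u_i-tu_j)(tu_i-qu_j)}\prod_i\mathfrak m(u_i)$ is formed first in this way, then multiplied by $P(u_1^{-1},\dots,u_\alpha^{-1})$, and then the constant term is taken. *)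

theory Defs
  imports
    "HOL-Library.Poly_Mapping"
    "HOL-Library.FuncSet"
    "HOL-Computational_Algebra.Polynomial"
    "HOL-Computational_Algebra.Fraction_Field"
    "HOL-Combinatorics.Permutations"
begin

section \<open>Rational functions over C(q,t)\<close>

text \<open>The coefficient field C(q,t) is the fraction field of C[q][t]. Rational functions are
  taken in countably many variables indexed by the naturals; the same type serves for the
  variables x and for the spectral parameters u, the variable with index k being read as
  \<open>x\<^sub>k\<close> or \<open>u\<^sub>k\<close>.\<close>

type_synonym coeff_field = "complex poly poly fract"
type_synonym mpol = "(nat \<Rightarrow>\<^sub>0 nat) \<Rightarrow>\<^sub>0 coeff_field"
type_synonym ratfun = "mpol fract"

definition const :: "coeff_field \<Rightarrow> ratfun" where
  "const c = Fract (Poly_Mapping.single 0 c) 1"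

definition X :: "nat \<Rightarrow> ratfun" where
  "X i = Fract (Poly_Mapping.single (Poly_Mapping.single i 1) 1) 1"

definition qq :: ratfun where
  "qq = const (Fract [:[:0, 1:]:] 1)"

definition tt :: ratfun where
  "tt = const (Fract [:0, 1:] 1)"

definition pol_vars :: "mpol \<Rightarrow> nat set" where
  "pol_vars p = (\<Union>m\<in>Poly_Mapping.keys p. Poly_Mapping.keys m)"

definition pol_subst :: "(nat \<Rightarrow> ratfun) \<Rightarrow> mpol \<Rightarrow> ratfun" where
  "pol_subst \<phi> p = (\<Sum>m\<in>Poly_Mapping.keys p. const (Poly_Mapping.lookup p m) *
      (\<Prod>i\<in>Poly_Mapping.keys m. \<phi> i ^ Poly_Mapping.lookup m i))"

text \<open>Substitution of \<open>\<phi> i\<close> for the i-th variable in a rational function. The value does not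
  depend on the representation with nonvanishing denominator; it is unspecified if there is no
  such representation, that is, if the function is not regular at \<open>\<phi>\<close>.\<close>

definition rat_subst :: "(nat \<Rightarrow> ratfun) \<Rightarrow> ratfun \<Rightarrow> ratfun" where
  "rat_subst \<phi> r = (THE v. \<exists>a b. r = Fract a b \<and> pol_subst \<phi> b \<noteq> 0 \<and>
      v = pol_subst \<phi> a / pol_subst \<phi> b)"

text \<open>The field of symmetric rational functions in the variables with indices \<open>1, \<dots>, n\<close>.\<close>

definition sym_ratfuns :: "nat \<Rightarrow> ratfun set" where
  "sym_ratfuns n = {r. (\<exists>a b. b \<noteq> 0 \<and> pol_vars a \<subseteq> {1..n} \<and> pol_vars b \<subseteq> {1..n} \<and> r = Fract a b) \<and>
      (\<forall>\<sigma>. \<sigma> permutes {1..n} \<longrightarrow> rat_subst (\<lambda>i. X (\<sigma> i)) r = r)}"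


section \<open>Shifts and currents\<close>

definition shift :: "nat \<Rightarrow> ratfun \<Rightarrow> ratfun" where
  "shift i = rat_subst (\<lambda>j. if j = i then qq * X j else X j)"

text \<open>The ordered composition of \<open>A k\<close> for \<open>k = 1, \<dots>, n\<close>, with \<open>A n\<close> acting first.\<close>

definition op_prod :: "nat \<Rightarrow> (nat \<Rightarrow> ratfun \<Rightarrow> ratfun) \<Rightarrow> ratfun \<Rightarrow> ratfun" where
  "op_prod n A = foldr (\<lambda>k B. A k \<circ> B) [1..<Suc n] id"

text \<open>Operator-valued formal distributions in \<open>u\<^sub>1, u\<^sub>2, \<dots>\<close>: \<open>J n\<close> is the coefficient of the
  monomial with exponents n.\<close>

type_synonym current = "(nat \<Rightarrow> int) \<Rightarrow> ratfun \<Rightarrow> ratfun"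

text \<open>The coefficient of the n-th power of u in the current m(u) for N variables.\<close>

definition m_coeff :: "nat \<Rightarrow> int \<Rightarrow> ratfun \<Rightarrow> ratfun" where
  "m_coeff N n f = (\<Sum>i\<in>{1..N}. X i powi n *
      (\<Prod>j\<in>{1..N} - {i}. (tt * X i - X j) / (X i - X j)) * shift i f)"

definition m_prod :: "nat \<Rightarrow> nat \<Rightarrow> current" where
  "m_prod N \<alpha> n = op_prod \<alpha> (\<lambda>k. m_coeff N (n k))"

text \<open>The terms \<open>\<Prod>\<^sub>k \<delta>(u\<^sub>k y\<^sub>k) \<Gamma>\<close> are indexed by pairs \<open>(y, g)\<close>, where \<open>\<Gamma>\<close> is
  the product of the powers \<open>g i\<close> of the shifts; functions are extensional so that an
  index is determined by its term.\<close>

type_synonym term_index = "(nat \<Rightarrow> ratfun) \<times> (nat \<Rightarrow> nat)"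

definition term_indices :: "nat \<Rightarrow> nat \<Rightarrow> term_index set" where
  "term_indices N \<alpha> =
    ({1..\<alpha>} \<rightarrow>\<^sub>E {qq powi a * X i | a i. i \<in> {1..N}}) \<times> ({1..N} \<rightarrow>\<^sub>E UNIV)"

definition delta_term :: "nat \<Rightarrow> nat \<Rightarrow> term_index \<Rightarrow> current" where
  "delta_term N \<alpha> = (\<lambda>(y, g) n f.
      (\<Prod>k\<in>{1..\<alpha>}. y k powi n k) * op_prod N (\<lambda>i. shift i ^^ g i) f)"

text \<open>\<open>C\<close> is the family of (nonzero) coefficients of an expansion of \<open>J\<close>, as operators on the
  symmetric rational functions in N variables, into finitely many delta terms. Distinct delta
  terms are linearly independent over the field of rational functions, so \<open>C\<close> is determined by \<open>J\<close>.\<close>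

definition is_delta_expansion ::
    "nat \<Rightarrow> nat \<Rightarrow> current \<Rightarrow> (term_index \<Rightarrow>\<^sub>0 ratfun) \<Rightarrow> bool" where
  "is_delta_expansion N \<alpha> J C \<longleftrightarrow> Poly_Mapping.keys C \<subseteq> term_indices N \<alpha> \<and>
    (\<forall>n. \<forall>f\<in>sym_ratfuns N. J n f =
      (\<Sum>s\<in>Poly_Mapping.keys C. Poly_Mapping.lookup C s * delta_term N \<alpha> s n f))"

text \<open>Multiplication of a current by a rational function R of the parameters u: in every term
  that occurs, R is replaced by its value at \<open>u\<^sub>k = 1 / y\<^sub>k\<close>.\<close>

definition current_mult :: "nat \<Rightarrow> nat \<Rightarrow> ratfun \<Rightarrow> current \<Rightarrow> current" where
  "current_mult N \<alpha> R J n f =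
    (let C = (THE C. is_delta_expansion N \<alpha> J C) in
      \<Sum>s\<in>Poly_Mapping.keys C. rat_subst (\<lambda>k. inverse (fst s k)) R *
        Poly_Mapping.lookup C s * delta_term N \<alpha> s n f)"

definition CT :: "current \<Rightarrow> ratfun \<Rightarrow> ratfun" where
  "CT J = J (\<lambda>_. 0)"


section \<open>The two families of operators\<close>

definition kernel :: "nat \<Rightarrow> ratfun" where
  "kernel \<alpha> = (\<Prod>i\<in>{1..\<alpha>}. \<Prod>j\<in>{i<..\<alpha>}.
      ((X i - X j) * (X i - qq * X j)) / ((X i - tt * X j) * (tt * X i - qq * X j)))"

definition M_op :: "nat \<Rightarrow> nat \<Rightarrow> ratfun \<Rightarrow> ratfun \<Rightarrow> ratfun" where
  "M_op N \<alpha> P f = 1 / of_nat (fact \<alpha>) *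
    CT (current_mult N \<alpha> (rat_subst (\<lambda>k. inverse (X k)) P)
         (current_mult N \<alpha> (kernel \<alpha>) (m_prod N \<alpha>))) f"

text \<open>The summand for \<open>\<sigma>\<close> is the operator \<open>P(x) \<Prod> (t x\<^sub>i - x\<^sub>j) / (x\<^sub>i - x\<^sub>j) \<Gamma>\<^sub>1 \<dots> \<Gamma>\<^sub>\<alpha>\<close>
  with the indices of all variables and shifts permuted by \<open>\<sigma>\<close>.\<close>

definition D_op :: "nat \<Rightarrow> nat \<Rightarrow> ratfun \<Rightarrow> ratfun \<Rightarrow> ratfun" where
  "D_op N \<alpha> P f = 1 / (of_nat (fact \<alpha>) * of_nat (fact (N - \<alpha>))) *
    (\<Sum>\<sigma> | \<sigma> permutes {1..N}.
      rat_subst (\<lambda>i. X (\<sigma> i)) P *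
      (\<Prod>i\<in>{1..\<alpha>}. \<Prod>j\<in>{\<alpha><..N}. (tt * X (\<sigma> i) - X (\<sigma> j)) / (X (\<sigma> i) - X (\<sigma> j))) *
      op_prod \<alpha> (\<lambda>k. shift (\<sigma> k)) f)"

end

theory Submission
  imports Defs
begin

text \<open>Expanding the product of currents gives one delta term for every sequence
  \<open>i\<^sub>1, \<dots>, i\<^sub>\<alpha>\<close> of indices. If an index is repeated, two consecutive occurrences give
  parameters with \<open>u\<^sub>k = q u\<^sub>l\<close>, so the kernel vanishes; if all indices are distinct, the
  kernel cancels exactly the factors of the coefficient in which both indices belong to the
  sequence. What remains is the summand of the generalized Macdonald operator, and every
  injective sequence extends to \<open>(N - \<alpha>)!\<close> permutations. That this computation is about
  the current itself, and not about one of its expansions, rests on Dedekind's independence of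
  characters: the pairs (exponent vector, symmetric function) form a monoid on which distinct
  delta terms are distinct characters, separated by the coordinate vectors and the sum of the
  variables.\<close>

section \<open>Substitution\<close>

definition mono_subst :: "(nat \<Rightarrow> ratfun) \<Rightarrow> (nat \<Rightarrow>\<^sub>0 nat) \<Rightarrow> ratfun" where
  "mono_subst \<phi> m = (\<Prod>i\<in>Poly_Mapping.keys m. \<phi> i ^ Poly_Mapping.lookup m i)"

lemma const_simps [simp]:
  "const 0 = 0" "const 1 = 1"
  "const (a + b) = const a + const b"
  "const (a * b) = const a * const b"
  by (simp_all add: const_def single_add mult_single fract_collapse)

lemma const_diff: "const (a - b) = const a - const b"
  by (simp add: const_def single_diff)

lemma const_power: "const (a ^ n) = const a ^ n"
  by (induction n) simp_all

lemma const_eq_iff [simp]: "const a = const b \<longleftrightarrow> a = b"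
  by (simp add: const_def eq_fract inj_eq)

lemma const_eq_0_iff [simp]: "const a = 0 \<longleftrightarrow> a = 0"
  using const_eq_iff[of a 0] by (simp del: const_eq_iff)

lemma mono_subst_superset:
  assumes "finite A" "Poly_Mapping.keys m \<subseteq> A"
  shows "mono_subst \<phi> m = (\<Prod>i\<in>A. \<phi> i ^ Poly_Mapping.lookup m i)"
  unfolding mono_subst_def
  by (rule prod.mono_neutral_left) (use assms in \<open>auto simp: in_keys_iff\<close>)

lemma mono_subst_add: "mono_subst \<phi> (m + m') = mono_subst \<phi> m * mono_subst \<phi> m'"
proof -
  let ?A = "Poly_Mapping.keys m \<union> Poly_Mapping.keys m'"
  have "Poly_Mapping.keys (m + m') \<subseteq> ?A" by (rule keys_add)
  then show ?thesis
    by (simp add: mono_subst_superset[of ?A] lookup_add power_add prod.distrib)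
qed

lemma pol_subst_superset:
  assumes "finite A" "Poly_Mapping.keys p \<subseteq> A"
  shows "pol_subst \<phi> p = (\<Sum>m\<in>A. const (Poly_Mapping.lookup p m) * mono_subst \<phi> m)"
  unfolding pol_subst_def mono_subst_def
  by (rule sum.mono_neutral_left) (use assms in \<open>auto simp: in_keys_iff\<close>)

lemma pol_subst_0 [simp]: "pol_subst \<phi> 0 = 0"
  by (simp add: pol_subst_def)

lemma pol_subst_add: "pol_subst \<phi> (p + q) = pol_subst \<phi> p + pol_subst \<phi> q"
proof -
  let ?A = "Poly_Mapping.keys p \<union> Poly_Mapping.keys q"
  have "Poly_Mapping.keys (p + q) \<subseteq> ?A" by (rule keys_add)
  then show ?thesis
    by (simp add: pol_subst_superset[of ?A] lookup_add sum.distrib algebra_simps)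
qed

lemma pol_subst_sum: "pol_subst \<phi> (\<Sum>i\<in>A. p i) = (\<Sum>i\<in>A. pol_subst \<phi> (p i))"
  by (induction A rule: infinite_finite_induct) (simp_all add: pol_subst_add)

lemma pol_subst_single: "pol_subst \<phi> (Poly_Mapping.single m c) = const c * mono_subst \<phi> m"
  by (subst pol_subst_superset[of "{m}"]) (auto simp: lookup_single)

lemma poly_mapping_sum_single:
  "p = (\<Sum>m\<in>Poly_Mapping.keys p. Poly_Mapping.single m (Poly_Mapping.lookup p m))"
  by (rule poly_mapping_eqI)
    (auto simp: lookup_sum lookup_single when_def in_keys_iff sum.delta)

lemma pol_subst_mult: "pol_subst \<phi> (p * q) = pol_subst \<phi> p * pol_subst \<phi> q"
proof -
  let ?s = "\<lambda>p m. Poly_Mapping.single m (Poly_Mapping.lookup p m) :: mpol"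
  have "p * q = (\<Sum>m\<in>Poly_Mapping.keys p. ?s p m) * (\<Sum>m\<in>Poly_Mapping.keys q. ?s q m)"
    using poly_mapping_sum_single[of p] poly_mapping_sum_single[of q] by simp
  also have "\<dots> = (\<Sum>m\<in>Poly_Mapping.keys p. \<Sum>m'\<in>Poly_Mapping.keys q. ?s p m * ?s q m')"
    by (simp add: sum_product)
  finally have *: "p * q = \<dots>" .
  show ?thesis unfolding *
    by (simp add: pol_subst_sum mult_single pol_subst_single mono_subst_add
        pol_subst_superset[OF _ order_refl, where p = p] pol_subst_superset[OF _ order_refl, where p = q]
        sum_product ac_simps)
qed

lemma pol_subst_1 [simp]: "pol_subst \<phi> 1 = 1"
  using pol_subst_single[of \<phi> 0 1] by (simp add: mono_subst_def)

lemma pol_subst_cong: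
  assumes "\<And>i. i \<in> pol_vars p \<Longrightarrow> \<phi> i = \<psi> i"
  shows "pol_subst \<phi> p = pol_subst \<psi> p"
  unfolding pol_subst_def using assms
  by (intro sum.cong prod.cong refl arg_cong2[where f = "(*)"] arg_cong2[where f = "(^)"])
    (auto simp: pol_vars_def)

lemma Fract_mult_1: "Fract (a * b) 1 = Fract a 1 * Fract b 1"
  and Fract_add_1: "Fract (a + b) 1 = Fract a 1 + Fract b 1"
  by simp_all

lemma Fract_prod: "Fract (\<Prod>i\<in>A. f i) 1 = (\<Prod>i\<in>A. Fract (f i) 1)"
  by (induction A rule: infinite_finite_induct)
    (simp_all add: fract_collapse Fract_mult_1 del: mult_fract)

lemma Fract_sum: "Fract (\<Sum>i\<in>A. f i) 1 = (\<Sum>i\<in>A. Fract (f i) 1)"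
  by (induction A rule: infinite_finite_induct)
    (simp_all add: fract_collapse Fract_add_1 del: add_fract)

lemma mono_subst_X: "mono_subst X m = Fract (Poly_Mapping.single m 1) 1"
proof -
  have pow: "X i ^ n = Fract (Poly_Mapping.single (Poly_Mapping.single i n) 1) 1" for i n
    by (induction n) (simp_all add: fract_collapse X_def mult_single flip: single_add)
  have "(\<Prod>i\<in>A. Poly_Mapping.single (Poly_Mapping.single i (k i)) (1::coeff_field)) =
      Poly_Mapping.single (\<Sum>i\<in>A. Poly_Mapping.single i (k i)) 1" if "finite A"
    for A and k :: "nat \<Rightarrow> nat"
    using that by (induction A) (simp_all add: mult_single)
  then show ?thesis
    by (simp add: mono_subst_def pow flip: Fract_prod poly_mapping_sum_single)
qed

text \<open>A composite substitution that fixes every variable thus returns the polynomial itself;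
  nonvanishing is proved below by reaching this case.\<close>

lemma pol_subst_X: "pol_subst X p = Fract p 1"
proof -
  have "pol_subst X p = (\<Sum>m\<in>Poly_Mapping.keys p. Fract (Poly_Mapping.single m (Poly_Mapping.lookup p m)) 1)"
    by (simp add: pol_subst_superset[OF _ order_refl] mono_subst_X const_def mult_single)
  also have "\<dots> = Fract p 1"
    using poly_mapping_sum_single[of p] by (simp flip: Fract_sum)
  finally show ?thesis .
qed

text \<open>Regularity of r at \<open>\<phi>\<close> together with the value; this keeps track of where
  the definite description in \<open>rat_subst\<close> is meaningful.\<close>

definition evals :: "(nat \<Rightarrow> ratfun) \<Rightarrow> ratfun \<Rightarrow> ratfun \<Rightarrow> bool" where
  "evals \<phi> r v \<longleftrightarrow> (\<exists>a b. r = Fract a b \<and> pol_subst \<phi> b \<noteq> 0 \<and>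
      v = pol_subst \<phi> a / pol_subst \<phi> b)"

lemma evalsI: "pol_subst \<phi> b \<noteq> 0 \<Longrightarrow> evals \<phi> (Fract a b) (pol_subst \<phi> a / pol_subst \<phi> b)"
  by (auto simp: evals_def)

lemma evalsE:
  assumes "evals \<phi> r v"
  obtains a b where "r = Fract a b" "b \<noteq> 0" "pol_subst \<phi> b \<noteq> 0"
    "v = pol_subst \<phi> a / pol_subst \<phi> b"
  using assms by (fastforce simp: evals_def)

text \<open>Cross-multiplying two representations gives a polynomial identity, which the ring
  homomorphism \<open>pol_subst \<phi>\<close> preserves, and both denominators have nonzero images.
  Hence \<open>rat_subst\<close> is well defined wherever r is regular.\<close>

lemma evals_unique:
  assumes "evals \<phi> r v" "evals \<phi> r w"
  shows "v = w"
proof -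
  from assms(1) obtain a b where 1: "r = Fract a b" "b \<noteq> 0" "pol_subst \<phi> b \<noteq> 0"
    "v = pol_subst \<phi> a / pol_subst \<phi> b" by (rule evalsE)
  from assms(2) obtain c d where 2: "r = Fract c d" "d \<noteq> 0" "pol_subst \<phi> d \<noteq> 0"
    "w = pol_subst \<phi> c / pol_subst \<phi> d" by (rule evalsE)
  from 1 2 have "a * d = c * b" by (simp add: eq_fract)
  then have "pol_subst \<phi> a * pol_subst \<phi> d = pol_subst \<phi> c * pol_subst \<phi> b"
    by (simp flip: pol_subst_mult)
  with 1 2 show ?thesis by (simp add: frac_eq_eq)
qed

lemma rat_subst_eqI:
  assumes "evals \<phi> r v"
  shows "rat_subst \<phi> r = v"
proof -
  have "rat_subst \<phi> r = (THE v. evals \<phi> r v)"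
    by (simp add: rat_subst_def evals_def)
  also have "\<dots> = v"
    using assms evals_unique by (intro the_equality) auto
  finally show ?thesis .
qed

lemma evals_add:
  assumes "evals \<phi> r v" "evals \<phi> s w"
  shows "evals \<phi> (r + s) (v + w)"
proof -
  from assms(1) obtain a b where 1: "r = Fract a b" "b \<noteq> 0" "pol_subst \<phi> b \<noteq> 0"
    "v = pol_subst \<phi> a / pol_subst \<phi> b" by (rule evalsE)
  from assms(2) obtain c d where 2: "s = Fract c d" "d \<noteq> 0" "pol_subst \<phi> d \<noteq> 0"
    "w = pol_subst \<phi> c / pol_subst \<phi> d" by (rule evalsE)
  show ?thesis
    using evalsI[of \<phi> "b * d" "a * d + c * b"] 1 2
    by (simp add: pol_subst_mult pol_subst_add add_frac_eq)
qed

lemma evals_mult: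
  assumes "evals \<phi> r v" "evals \<phi> s w"
  shows "evals \<phi> (r * s) (v * w)"
proof -
  from assms(1) obtain a b where 1: "r = Fract a b" "b \<noteq> 0" "pol_subst \<phi> b \<noteq> 0"
    "v = pol_subst \<phi> a / pol_subst \<phi> b" by (rule evalsE)
  from assms(2) obtain c d where 2: "s = Fract c d" "d \<noteq> 0" "pol_subst \<phi> d \<noteq> 0"
    "w = pol_subst \<phi> c / pol_subst \<phi> d" by (rule evalsE)
  show ?thesis
    using evalsI[of \<phi> "b * d" "a * c"] 1 2 by (simp add: pol_subst_mult)
qed

lemma evals_inverse:
  assumes "evals \<phi> r v" "v \<noteq> 0"
  shows "evals \<phi> (inverse r) (inverse v)"
proof -
  from assms(1) obtain a b where 1: "r = Fract a b" "b \<noteq> 0" "pol_subst \<phi> b \<noteq> 0"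
    "v = pol_subst \<phi> a / pol_subst \<phi> b" by (rule evalsE)
  show ?thesis
    using evalsI[of \<phi> a b] 1 assms(2) by simp
qed

lemma evals_divide:
  assumes "evals \<phi> r v" "evals \<phi> s w" "w \<noteq> 0"
  shows "evals \<phi> (r / s) (v / w)"
  using evals_mult[OF assms(1) evals_inverse[OF assms(2,3)]] by (simp add: divide_inverse)

lemma evals_const: "evals \<phi> (const c) (const c)"
  using evalsI[of \<phi> 1 "Poly_Mapping.single 0 c"]
  by (simp add: pol_subst_single const_def mono_subst_def)

lemma evals_X: "evals \<phi> (X i) (\<phi> i)"
  using evalsI[of \<phi> 1 "Poly_Mapping.single (Poly_Mapping.single i 1) 1"]
  by (simp add: pol_subst_single X_def mono_subst_def)

lemma evals_qq: "evals \<phi> qq qq" and evals_tt: "evals \<phi> tt tt"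
  by (simp_all add: qq_def tt_def evals_const)

lemma evals_0: "evals \<phi> 0 0" and evals_1: "evals \<phi> 1 1"
  using evals_const[of \<phi> 0] evals_const[of \<phi> 1] by simp_all

lemma evals_diff:
  assumes "evals \<phi> r v" "evals \<phi> s w"
  shows "evals \<phi> (r - s) (v - w)"
  using evals_add[OF assms(1) evals_mult[OF evals_const[of _ "-1"] assms(2)]]
  by (simp add: const_diff[of 0 1, simplified])

lemma evals_power: "evals \<phi> r v \<Longrightarrow> evals \<phi> (r ^ n) (v ^ n)"
  by (induction n) (simp_all add: evals_mult evals_1)

lemma evals_powi: "evals \<phi> r v \<Longrightarrow> v \<noteq> 0 \<Longrightarrow> evals \<phi> (r powi n) (v powi n)"
  by (auto simp: power_int_def intro: evals_power evals_inverse)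

lemma evals_sum: "(\<And>i. i \<in> A \<Longrightarrow> evals \<phi> (r i) (v i)) \<Longrightarrow> evals \<phi> (\<Sum>i\<in>A. r i) (\<Sum>i\<in>A. v i)"
  by (induction A rule: infinite_finite_induct) (simp_all add: evals_add evals_0)

lemma evals_prod: "(\<And>i. i \<in> A \<Longrightarrow> evals \<phi> (r i) (v i)) \<Longrightarrow> evals \<phi> (\<Prod>i\<in>A. r i) (\<Prod>i\<in>A. v i)"
  by (induction A rule: infinite_finite_induct) (simp_all add: evals_mult evals_1)

lemmas evals_intros = evals_add evals_mult evals_divide evals_const evals_X evals_qq evals_tt
  evals_0 evals_1 evals_diff evals_power evals_powi evals_sum evals_prod

lemma evals_pol_subst:
  assumes "\<And>i. i \<in> pol_vars p \<Longrightarrow> evals \<psi> (\<phi> i) (\<chi> i)"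
  shows "evals \<psi> (pol_subst \<phi> p) (pol_subst \<chi> p)"
  unfolding pol_subst_def by (intro evals_intros assms) (auto simp: pol_vars_def)

text \<open>Left inverse criterion: substituting \<open>\<psi>\<close> after \<open>\<phi>\<close>
  restores p, whereas it would send a vanishing \<open>pol_subst \<phi> p\<close> to zero.\<close>

lemma pol_subst_nonzero:
  assumes "p \<noteq> 0" "\<And>i. i \<in> pol_vars p \<Longrightarrow> evals \<psi> (\<phi> i) (X i)"
  shows "pol_subst \<phi> p \<noteq> 0"
proof
  assume "pol_subst \<phi> p = 0"
  with evals_pol_subst[of p \<psi> \<phi> X] assms(2) have "evals \<psi> 0 (Fract p 1)"
    by (simp add: pol_subst_X)
  then have "Fract p 1 = 0" using evals_0 evals_unique by blast
  with assms(1) show False by (simp add: Zero_fract_def eq_fract)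
qed

text \<open>Composition of partial substitutions. A denominator vanishing at \<open>\<phi>\<close>
  would still vanish after \<open>\<psi>\<close>, so regularity at the composite
  \<open>\<chi>\<close> forces regularity at \<open>\<phi>\<close>. The set V leaves the
  substitutions unconstrained at variables that do not occur.\<close>

lemma evals_rat_subst:
  assumes "pol_vars a \<subseteq> V" "pol_vars b \<subseteq> V" "pol_subst \<chi> b \<noteq> 0"
    "\<And>i. i \<in> V \<Longrightarrow> evals \<psi> (\<phi> i) (\<chi> i)"
  shows "evals \<psi> (rat_subst \<phi> (Fract a b)) (rat_subst \<chi> (Fract a b))"
proof -
  have *: "evals \<psi> (pol_subst \<phi> p) (pol_subst \<chi> p)" if "pol_vars p \<subseteq> V" for p
    using that assms(4) by (intro evals_pol_subst) auto
  have "pol_subst \<phi> b \<noteq> 0"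
  proof
    assume "pol_subst \<phi> b = 0"
    with *[of b] assms have "evals \<psi> 0 (pol_subst \<chi> b)" by simp
    with assms(3) show False using evals_0 evals_unique by blast
  qed
  then show ?thesis
    using assms * by (simp add: rat_subst_eqI[OF evalsI] evals_divide)
qed

text \<open>Injectivity on polynomials, so that the substitution extends to an embedding of the
  whole field and \<open>rat_subst\<close> is never unspecified.\<close>

definition embeds :: "(nat \<Rightarrow> ratfun) \<Rightarrow> bool" where
  "embeds \<phi> \<longleftrightarrow> (\<forall>p. p \<noteq> 0 \<longrightarrow> pol_subst \<phi> p \<noteq> 0)"

lemma embedsI:
  assumes "\<And>i. evals \<psi> (\<phi> i) (X i)"
  shows "embeds \<phi>"
  unfolding embeds_def using pol_subst_nonzero assms by blast

lemma embeds_evals: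
  assumes "embeds \<phi>" shows "evals \<phi> r (rat_subst \<phi> r)"
proof (cases r)
  case (Fract a b)
  with assms have "evals \<phi> r (pol_subst \<phi> a / pol_subst \<phi> b)"
    by (simp add: embeds_def evalsI)
  then show ?thesis using rat_subst_eqI by simp
qed

lemma rat_subst_X [simp]: "rat_subst \<phi> (X i) = \<phi> i"
  and rat_subst_const [simp]: "rat_subst \<phi> (const c) = const c"
  and rat_subst_qq [simp]: "rat_subst \<phi> qq = qq"
  and rat_subst_tt [simp]: "rat_subst \<phi> tt = tt"
  and rat_subst_0 [simp]: "rat_subst \<phi> 0 = 0"
  and rat_subst_1 [simp]: "rat_subst \<phi> 1 = 1"
  by (intro rat_subst_eqI evals_intros)+

section \<open>Rules for substitutions that embed the field\<close>

context
  fixes \<phi> assumes emb: "embeds \<phi>"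
begin

lemma rat_subst_diff: "rat_subst \<phi> (r - s) = rat_subst \<phi> r - rat_subst \<phi> s"
  and rat_subst_mult: "rat_subst \<phi> (r * s) = rat_subst \<phi> r * rat_subst \<phi> s"
  by (intro rat_subst_eqI evals_intros embeds_evals emb)+

lemma rat_subst_eq_0_iff: "rat_subst \<phi> r = 0 \<longleftrightarrow> r = 0"
proof
  assume *: "rat_subst \<phi> r = 0"
  show "r = 0"
  proof (rule ccontr)
    assume "r \<noteq> 0"
    then have "rat_subst \<phi> (r * inverse r) = 1" by simp
    then show False using * by (simp add: rat_subst_mult)
  qed
qed simp

lemma rat_subst_divide: "rat_subst \<phi> (r / s) = rat_subst \<phi> r / rat_subst \<phi> s"
proof (cases "s = 0")
  case False
  then show ?thesis by (intro rat_subst_eqI evals_intros embeds_evals emb) (simp add: rat_subst_eq_0_iff)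
qed simp

lemma rat_subst_powi: "rat_subst \<phi> (r powi n) = rat_subst \<phi> r powi n"
proof (cases "r = 0")
  case False
  then show ?thesis by (intro rat_subst_eqI evals_intros embeds_evals emb) (simp add: rat_subst_eq_0_iff)
qed (simp add: power_int_0_left_if)

lemma rat_subst_sum: "rat_subst \<phi> (\<Sum>i\<in>A. r i) = (\<Sum>i\<in>A. rat_subst \<phi> (r i))"
  and rat_subst_prod: "rat_subst \<phi> (\<Prod>i\<in>A. r i) = (\<Prod>i\<in>A. rat_subst \<phi> (r i))"
  by (intro rat_subst_eqI evals_intros embeds_evals emb)+

end

lemma rat_subst_compose:
  assumes "embeds \<phi>" "embeds \<psi>"
  shows "rat_subst \<psi> (rat_subst \<phi> r) = rat_subst (\<lambda>i. rat_subst \<psi> (\<phi> i)) r"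
proof (cases r)
  case (Fract a b)
  have *: "rat_subst \<psi> (pol_subst \<phi> p) = pol_subst (\<lambda>i. rat_subst \<psi> (\<phi> i)) p" for p
    by (intro rat_subst_eqI evals_pol_subst embeds_evals assms)
  have "pol_subst (\<lambda>i. rat_subst \<psi> (\<phi> i)) b \<noteq> 0"
    unfolding *[symmetric] using Fract assms by (simp add: rat_subst_eq_0_iff embeds_def)
  then show ?thesis
    unfolding Fract(1)
    by (intro rat_subst_eqI evals_rat_subst[where V = UNIV] embeds_evals assms(2)) auto
qed


section \<open>Monomials in q, t and one variable\<close>

definition qc :: coeff_field where "qc = Fract [:[:0, 1:]:] 1"

definition tc :: coeff_field where "tc = Fract [:0, 1:] 1"

lemma qq_eq_const: "qq = const qc" and tt_eq_const: "tt = const tc"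
  by (simp_all add: qq_def qc_def tt_def tc_def)

lemma qc_power: "qc ^ n = Fract [:[:0, 1:] ^ n:] 1"
proof -
  have "Fract p 1 ^ n = Fract (p ^ n) (1 :: complex poly poly)" for p
    by (induction n) (simp_all add: fract_collapse)
  then show ?thesis by (simp add: qc_def poly_const_pow)
qed

lemma qc_neq_0 [simp]: "qc \<noteq> 0" and tc_neq_0 [simp]: "tc \<noteq> 0"
  by (simp_all add: qc_def tc_def Zero_fract_def eq_fract)

lemma qc_power_eq_iff [simp]: "qc ^ m = qc ^ n \<longleftrightarrow> m = n"
proof
  assume "qc ^ m = qc ^ n"
  then have "[:0, 1 :: complex:] ^ m = [:0, 1:] ^ n"
    by (simp add: qc_power eq_fract)
  then have "degree ([:0, 1 :: complex:] ^ m) = degree ([:0, 1 :: complex:] ^ n)"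
    by simp
  then show "m = n" using degree_linear_power[of "0::complex"] by simp
qed simp

text \<open>The two sides have different degrees in t. This is what keeps the denominators of the
  kernel nonzero.\<close>

lemma tc_qc_power_neq [simp]: "tc * qc ^ m \<noteq> qc ^ n"
  by (simp add: qc_power tc_def eq_fract)

lemma qq_neq_0 [simp]: "qq \<noteq> 0" and tt_neq_0 [simp]: "tt \<noteq> 0"
  by (simp_all add: qq_eq_const tt_eq_const)

lemma sum_const_X:
  "(\<Sum>i\<in>A. const (c i) * X i) =
    Fract (\<Sum>i\<in>A. Poly_Mapping.single (Poly_Mapping.single i 1) (c i)) 1"
  by (simp add: const_def X_def mult_single Fract_sum)

lemma single_1_eq_iff [simp]:
  "Poly_Mapping.single i (1::nat) = Poly_Mapping.single j 1 \<longleftrightarrow> i = j"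
  by (metis keys_single singleton_inject zero_neq_one)

lemma sum_const_X_eqD:
  assumes "(\<Sum>i\<in>A. const (c i) * X i) = (\<Sum>i\<in>A. const (d i) * X i)" "finite A" "i \<in> A"
  shows "c i = d i"
proof -
  have *: "Poly_Mapping.lookup (\<Sum>i\<in>A. Poly_Mapping.single (Poly_Mapping.single i (1::nat)) (c i))
      (Poly_Mapping.single i 1) = c i" for c :: "nat \<Rightarrow> coeff_field"
    using assms(2,3) by (simp add: lookup_sum lookup_single when_def del: One_nat_def)
  from assms(1) have "(\<Sum>i\<in>A. Poly_Mapping.single (Poly_Mapping.single i (1::nat)) (c i)) =
      (\<Sum>i\<in>A. Poly_Mapping.single (Poly_Mapping.single i 1) (d i))"
    by (simp add: sum_const_X eq_fract)
  with *[of c] *[of d] show ?thesis by simp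
qed

lemma const_X_eq_iff:
  assumes "c \<noteq> 0"
  shows "const c * X i = const d * X j \<longleftrightarrow> c = d \<and> i = j"
proof
  assume eq: "const c * X i = const d * X j"
  \<comment> \<open>Both sides become linear forms over a common index set, so that coefficients of
    \<open>X i\<close> can be compared; for i different from j the comparison would read c =
    0.\<close>
  let ?c = "\<lambda>k. if k = i then c else 0" and ?d = "\<lambda>k. if k = j then d else 0"
  have s: "(\<Sum>k\<in>{i,j}. const (if k = l then e else 0) * X k) = const e * X l" if "l \<in> {i,j}" for e l
  proof -
    have "(\<Sum>k\<in>{i,j}. const (if k = l then e else 0) * X k) =
        (\<Sum>k\<in>{i,j}. if k = l then const e * X k else 0)"
      by (intro sum.cong) auto
    then show ?thesis using that by (subst (asm) sum.delta) auto
  qed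
  have "?c i = ?d i"
    by (rule sum_const_X_eqD[where A = "{i,j}"]) (use eq s[of i c] s[of j d] in auto)
  with assms show "c = d \<and> i = j" by (auto split: if_splits)
qed simp

lemma X_eq_iff [simp]: "X i = X j \<longleftrightarrow> i = j"
  using const_X_eq_iff[of 1 i 1 j] by simp

lemma X_neq_0 [simp]: "X i \<noteq> 0"
  by (simp add: X_def Zero_fract_def eq_fract)
    (metis keys_single keys_zero insert_not_empty zero_neq_one)

text \<open>Characteristic zero, used to cancel (N - \<alpha>)! at the end.\<close>

lemma of_nat_ratfun_neq_0:
  assumes "n \<noteq> 0"
  shows "(of_nat n :: ratfun) \<noteq> 0"
proof -
  have "(of_nat n :: coeff_field) \<noteq> 0"
    using assms by (simp add: of_nat_fract Zero_fract_def eq_fract)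
  moreover have "(of_nat n :: ratfun) = const (of_nat n)"
    by (simp add: const_def of_nat_fract[where 'a = mpol])
  ultimately show ?thesis by simp
qed


section \<open>Products of shifts\<close>

text \<open>Normal form for products of shifts: composition adds the exponent functions, so the
  order of the factors is forgotten.\<close>

definition scale :: "(nat \<Rightarrow> nat) \<Rightarrow> ratfun \<Rightarrow> ratfun" where
  "scale g = rat_subst (\<lambda>j. qq ^ g j * X j)"

lemma embeds_scale: "embeds (\<lambda>j. qq ^ g j * X j)"
proof (rule embedsI)
  let ?\<psi> = "\<lambda>j. inverse (qq ^ g j) * X j"
  show "evals ?\<psi> (qq ^ g i * X i) (X i)" for i
    using evals_mult[OF evals_power[OF evals_qq, of ?\<psi> "g i"] evals_X[of ?\<psi> i]]
    by (simp add: mult.assoc[symmetric])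
qed

lemmas scale_diff = rat_subst_diff[OF embeds_scale, folded scale_def]
lemmas scale_mult = rat_subst_mult[OF embeds_scale, folded scale_def]
lemmas scale_divide = rat_subst_divide[OF embeds_scale, folded scale_def]
lemmas scale_powi = rat_subst_powi[OF embeds_scale, folded scale_def]
lemmas scale_sum = rat_subst_sum[OF embeds_scale, folded scale_def]
lemmas scale_prod = rat_subst_prod[OF embeds_scale, folded scale_def]

lemma scale_simps [simp]:
  "scale g (X j) = qq ^ g j * X j" "scale g (const c) = const c"
  "scale g qq = qq" "scale g tt = tt" "scale g 1 = 1" "scale g 0 = 0"
  by (simp_all add: scale_def)

lemma scale_scale: "scale g (scale h r) = scale (\<lambda>j. g j + h j) r"
proof -
  have "scale g (qq ^ h i * X i) = qq ^ (g i + h i) * X i" for i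
    using scale_powi[of g qq "int (h i)"] by (simp add: scale_mult power_add)
  then show ?thesis
    by (simp add: scale_def rat_subst_compose[OF embeds_scale embeds_scale])
qed

lemma scale_0: "scale (\<lambda>_. 0) r = r"
proof -
  obtain a b where "r = Fract a b" "b \<noteq> 0" by (cases r)
  then show ?thesis
    using evalsI[of X b a] by (auto simp: scale_def pol_subst_X eq_fract Zero_fract_def
        intro: rat_subst_eqI)
qed

lemma shift_eq_scale: "shift i = scale (\<lambda>j. if j = i then 1 else 0)"
  unfolding shift_def scale_def by (intro arg_cong[where f = rat_subst] ext) simp

lemma shift_power_eq_scale: "shift i ^^ n = scale (\<lambda>j. if j = i then n else 0)"
proof (induction n)
  case 0
  then show ?case by (auto simp: scale_0 cong: if_cong)
next
  case (Suc n)
  then show ?case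
    by (auto simp: shift_eq_scale scale_scale fun_eq_iff intro!: arg_cong2[where f = scale])
qed

lemma op_prod_0 [simp]: "op_prod 0 A = id"
  by (simp add: op_prod_def)

text \<open>The fold exposes the first factor, but induction on the number of currents needs the
  last one, which acts first; associativity of composition moves it out.\<close>

lemma op_prod_Suc: "op_prod (Suc n) A = op_prod n A \<circ> A (Suc n)"
proof -
  have "foldr (\<lambda>k B. A k \<circ> B) ks C = foldr (\<lambda>k B. A k \<circ> B) ks id \<circ> C" for ks C
    by (induction ks) (simp_all add: comp_assoc)
  from this[of "[1..<Suc n]" "A (Suc n)"] show ?thesis
    by (simp add: op_prod_def)
qed

lemma op_prod_scale: "op_prod n (\<lambda>k. scale (h k)) = scale (\<lambda>j. \<Sum>k\<in>{1..n}. h k j)"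
proof (induction n)
  case 0
  then show ?case by (auto simp: scale_0)
next
  case (Suc n)
  then show ?case by (auto simp: op_prod_Suc scale_scale)
qed

text \<open>The exponent of the j-th shift in the product of the first k shifts of the sequence i;
  at \<open>k - 1\<close> it records how the earlier factors act on the k-th.\<close>

definition occ :: "(nat \<Rightarrow> nat) \<Rightarrow> nat \<Rightarrow> nat \<Rightarrow> nat" where
  "occ i k j = card {l \<in> {1..k}. i l = j}"

lemma op_prod_shift: "op_prod n (\<lambda>k. shift (i k)) = scale (occ i n)"
proof -
  have "(\<Sum>k\<in>{1..n}. if j = i k then 1 else 0) = occ i n j" for j
    by (simp add: occ_def sum.If_cases Int_def eq_commute[of j])
  then show ?thesis
    by (simp add: shift_eq_scale op_prod_scale)
qed

lemma op_prod_shift_power: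
  "op_prod n (\<lambda>i. shift i ^^ g i) = scale (\<lambda>j. if j \<in> {1..n} then g j else 0)"
  by (simp add: shift_power_eq_scale op_prod_scale)


section \<open>Linear independence of the delta terms\<close>

text \<open>Evaluating the relation at \<open>op m0 m\<close> and subtracting
  \<open>\<chi> s0 m0\<close> times the relation at m eliminates s0 and multiplies every other
  coefficient by \<open>\<chi> s m0 - \<chi> s0 m0\<close>. If m0 separates s from s0, the factor at
  s is nonzero and can be cancelled.\<close>

lemma dedekind_independence:
  fixes \<chi> :: "'s \<Rightarrow> 'm \<Rightarrow> 'k::idom"
  assumes "finite F"
    and mult_closed: "\<And>m m'. m \<in> M \<Longrightarrow> m' \<in> M \<Longrightarrow> op m m' \<in> M"
    and "e \<in> M"
    and "\<And>s. s \<in> F \<Longrightarrow> \<chi> s e = 1"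
    and "\<And>s m m'. s \<in> F \<Longrightarrow> m \<in> M \<Longrightarrow> m' \<in> M \<Longrightarrow> \<chi> s (op m m') = \<chi> s m * \<chi> s m'"
    and "\<And>s s'. s \<in> F \<Longrightarrow> s' \<in> F \<Longrightarrow> s \<noteq> s' \<Longrightarrow> \<exists>m\<in>M. \<chi> s m \<noteq> \<chi> s' m"
    and "\<And>m. m \<in> M \<Longrightarrow> (\<Sum>s\<in>F. c s * \<chi> s m) = 0"
    and "s \<in> F"
  shows "c s = 0"
  using assms(1,4-)
proof (induction F arbitrary: c s rule: finite_induct)
  case (insert s0 F)
  have F: "c s = 0" if s: "s \<in> F" for s
  proof -
    from insert.prems(3)[of s s0] s insert.hyps obtain m0
      where m0: "m0 \<in> M" "\<chi> s m0 \<noteq> \<chi> s0 m0" by auto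
    have "c s * (\<chi> s m0 - \<chi> s0 m0) = 0"
    proof (rule insert.IH[where c = "\<lambda>s. c s * (\<chi> s m0 - \<chi> s0 m0)"])
      fix m assume m: "m \<in> M"
      have "(\<Sum>s\<in>insert s0 F. c s * \<chi> s (op m0 m)) - \<chi> s0 m0 * (\<Sum>s\<in>insert s0 F. c s * \<chi> s m) = 0"
        by (simp add: insert.prems(4) m m0 mult_closed del: sum.insert)
      also have "(\<Sum>s\<in>insert s0 F. c s * \<chi> s (op m0 m)) - \<chi> s0 m0 * (\<Sum>s\<in>insert s0 F. c s * \<chi> s m)
          = (\<Sum>s\<in>insert s0 F. c s * (\<chi> s m0 - \<chi> s0 m0) * \<chi> s m)"
        unfolding sum_distrib_left sum_subtractf[symmetric]
        by (intro sum.cong refl) (simp add: insert.prems(2) m m0 algebra_simps)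
      finally show "(\<Sum>s\<in>F. c s * (\<chi> s m0 - \<chi> s0 m0) * \<chi> s m) = 0"
        using insert.hyps by simp
    qed (use insert.prems s in auto)
    with m0 show ?thesis by simp
  qed
  \<comment> \<open>All other coefficients being zero, the relation at e isolates
    \<open>c s0\<close>, since the characters are 1 there.\<close>
  have "(\<Sum>s\<in>insert s0 F. c s * \<chi> s e) = 0" using insert.prems(4) \<open>e \<in> M\<close> by blast
  then have "c s0 = 0" using insert.hyps insert.prems(1) F by simp
  with F insert.prems(5) show ?case by auto
qed simp

section \<open>Symmetric functions as arguments of the delta terms\<close>

lemma embeds_permutes: "\<sigma> permutes A \<Longrightarrow> embeds (\<lambda>i. X (\<sigma> i))"
  by (rule embedsI[where \<psi> = "\<lambda>i. X (inv \<sigma> i)"]) (metis evals_X permutes_inverses(2))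

lemma sym_ratfuns_1: "1 \<in> sym_ratfuns n"
proof -
  have "pol_vars 1 = {}" by (simp add: pol_vars_def)
  then show ?thesis
    by (auto simp: sym_ratfuns_def One_fract_def intro!: exI[of _ "1::mpol"])
      (simp flip: One_fract_def)
qed

lemma pol_vars_mult: "pol_vars (a * b) \<subseteq> pol_vars a \<union> pol_vars b"
  unfolding pol_vars_def using keys_mult[of a b] keys_add by fastforce

lemma sym_ratfuns_mult:
  assumes "f \<in> sym_ratfuns n" "g \<in> sym_ratfuns n"
  shows "f * g \<in> sym_ratfuns n"
proof -
  from assms obtain a b c d where
    "b \<noteq> 0" "pol_vars a \<subseteq> {1..n}" "pol_vars b \<subseteq> {1..n}" "f = Fract a b"
    "d \<noteq> 0" "pol_vars c \<subseteq> {1..n}" "pol_vars d \<subseteq> {1..n}" "g = Fract c d"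
    unfolding sym_ratfuns_def by blast
  then have "\<exists>a b. b \<noteq> 0 \<and> pol_vars a \<subseteq> {1..n} \<and> pol_vars b \<subseteq> {1..n} \<and> f * g = Fract a b"
    using pol_vars_mult[of a c] pol_vars_mult[of b d]
    by (intro exI[of _ "a * c"] exI[of _ "b * d"]) auto
  with assms show ?thesis
    by (auto simp: sym_ratfuns_def rat_subst_mult[OF embeds_permutes])
qed

lemma power_sum_in_sym_ratfuns: "(\<Sum>i\<in>{1..n}. X i) \<in> sym_ratfuns n"
proof -
  let ?p = "\<Sum>i\<in>{1..n}. Poly_Mapping.single (Poly_Mapping.single i 1) 1 :: mpol"
  have 1: "(\<Sum>i\<in>{1..n}. X i) = Fract ?p 1"
    by (simp add: X_def Fract_sum)
  have "pol_vars ?p \<subseteq> {1..n}"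
    using keys_sum[of "\<lambda>i. Poly_Mapping.single (Poly_Mapping.single i 1) 1 :: mpol" "{1..n}"]
    by (auto simp: pol_vars_def split: if_splits)
  then have 2: "\<exists>a b. b \<noteq> 0 \<and> pol_vars a \<subseteq> {1..n} \<and> pol_vars b \<subseteq> {1..n} \<and>
      (\<Sum>i\<in>{1..n}. X i) = Fract a b"
    unfolding 1 by (intro exI[of _ ?p] exI[of _ "1::mpol"]) (auto simp: pol_vars_def)
  have "rat_subst (\<lambda>i. X (\<sigma> i)) (\<Sum>i\<in>{1..n}. X i) = (\<Sum>i\<in>{1..n}. X i)"
    if "\<sigma> permutes {1..n}" for \<sigma>
    unfolding rat_subst_sum[OF embeds_permutes[OF that]] rat_subst_X
    using sum.permute[OF that, of X, symmetric] by (simp only: comp_def)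
  with 2 show ?thesis by (simp add: sym_ratfuns_def)
qed

text \<open>An extensional g is \<open>undefined\<close> outside 1..N; the conditional puts exponent
  0 there, since \<open>op_prod N\<close> applies no shift with such an index.\<close>

lemma delta_term_eq:
  "delta_term N \<alpha> (y, g) n f =
    (\<Prod>k\<in>{1..\<alpha>}. y k powi n k) * scale (\<lambda>j. if j \<in> {1..N} then g j else 0) f"
  by (simp add: delta_term_def op_prod_shift_power)

lemma term_indices_neq_0:
  assumes "(y, g) \<in> term_indices N \<alpha>" "k \<in> {1..\<alpha>}"
  shows "y k \<noteq> 0"
proof -
  from assms have "y k \<in> {qq powi a * X i | a i. i \<in> {1..N}}"
    by (auto simp: term_indices_def dest: PiE_mem)
  then show ?thesis by (auto simp: power_int_eq_0_iff)
qed

lemma delta_term_separation: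
  assumes s: "s \<in> term_indices N \<alpha>" "s' \<in> term_indices N \<alpha>" "s \<noteq> s'"
  shows "\<exists>n. \<exists>f\<in>sym_ratfuns N. delta_term N \<alpha> s n f \<noteq> delta_term N \<alpha> s' n f"
proof -
  obtain y g y' g' where yg: "s = (y, g)" "s' = (y', g')" by (cases s, cases s') auto
  from s yg have ext: "y \<in> extensional {1..\<alpha>}" "y' \<in> extensional {1..\<alpha>}"
      "g \<in> extensional {1..N}" "g' \<in> extensional {1..N}"
    by (auto simp: term_indices_def PiE_def)
  show ?thesis
  proof (cases "y = y'")
    case False
    \<comment> \<open>The coordinate vector at k, paired with the function 1, extracts
      \<open>y k\<close>, because scaling fixes 1.\<close>
    with ext obtain k where k: "k \<in> {1..\<alpha>}" "y k \<noteq> y' k"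
      by (meson extensionalityI)
    have "(\<Prod>l\<in>{1..\<alpha>}. z l powi (if l = k then 1 else 0)) = z k" for z :: "nat \<Rightarrow> ratfun"
    proof -
      have "(\<Prod>l\<in>{1..\<alpha>}. z l powi (if l = k then 1 else 0)) = (\<Prod>l\<in>{1..\<alpha>}. if l = k then z l else 1)"
        by (intro prod.cong) auto
      then show ?thesis using k(1) by (subst (asm) prod.delta) auto
    qed
    then have "delta_term N \<alpha> s (\<lambda>l. if l = k then 1 else 0) 1 \<noteq>
        delta_term N \<alpha> s' (\<lambda>l. if l = k then 1 else 0) 1"
      using k yg by (simp add: delta_term_eq)
    with sym_ratfuns_1 show ?thesis by blast
  next
    case True
    with s(3) yg have "g \<noteq> g'" by simp
    with ext obtain i where i: "i \<in> {1..N}" "g i \<noteq> g' i"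
      by (meson extensionalityI)
    \<comment> \<open>The zero exponent vector removes y, and the sum of the variables shows the
      powers of q as coefficients of a linear form.\<close>
    have *: "delta_term N \<alpha> (y, g) (\<lambda>_. 0) (\<Sum>i\<in>{1..N}. X i) = (\<Sum>i\<in>{1..N}. const (qc ^ g i) * X i)"
      for y g
      by (simp add: delta_term_eq scale_sum qq_eq_const const_power)
    have "delta_term N \<alpha> s (\<lambda>_. 0) (\<Sum>i\<in>{1..N}. X i) \<noteq> delta_term N \<alpha> s' (\<lambda>_. 0) (\<Sum>i\<in>{1..N}. X i)"
    proof
      assume "delta_term N \<alpha> s (\<lambda>_. 0) (\<Sum>i\<in>{1..N}. X i) = delta_term N \<alpha> s' (\<lambda>_. 0) (\<Sum>i\<in>{1..N}. X i)"
      then have "qc ^ g i = qc ^ g' i"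
        unfolding yg * by (rule sum_const_X_eqD) (use i in auto)
      with i show False by simp
    qed
    with power_sum_in_sym_ratfuns show ?thesis by blast
  qed
qed

text \<open>Exponent vectors add and functions multiply. A delta term respects this because integer
  powers of the nonzero \<open>y k\<close> turn sums into products and \<open>scale\<close> is
  multiplicative.\<close>

lemma delta_term_independence:
  assumes "finite F" "F \<subseteq> term_indices N \<alpha>"
    and "\<And>n f. f \<in> sym_ratfuns N \<Longrightarrow> (\<Sum>s\<in>F. c s * delta_term N \<alpha> s n f) = 0"
    and "s \<in> F"
  shows "c s = 0"
proof (rule dedekind_independence[where F = F and s = s and c = c
      and M = "{(n, f). f \<in> sym_ratfuns N}" and e = "(\<lambda>_. 0, 1)"
      and op = "\<lambda>(n, f) (n', f'). (\<lambda>k. n k + n' k, f * f')"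
      and \<chi> = "\<lambda>s (n, f). delta_term N \<alpha> s n f"])
  show "(case m of (n, f) \<Rightarrow> \<lambda>(n', f'). (\<lambda>k. n k + n' k, f * f')) m' \<in> {(n, f). f \<in> sym_ratfuns N}"
    if "m \<in> {(n, f). f \<in> sym_ratfuns N}" "m' \<in> {(n, f). f \<in> sym_ratfuns N}"
    for m m' :: "(nat \<Rightarrow> int) \<times> ratfun"
    using that by (auto simp: sym_ratfuns_mult)
next
  fix s and m m' :: "(nat \<Rightarrow> int) \<times> ratfun"
  assume "s \<in> F"
  with assms(2) have "s \<in> term_indices N \<alpha>" by blast
  then show "(case (case m of (n, f) \<Rightarrow> \<lambda>(n', f'). (\<lambda>k. n k + n' k, f * f')) m' of
        (n, f) \<Rightarrow> delta_term N \<alpha> s n f) =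
      (case m of (n, f) \<Rightarrow> delta_term N \<alpha> s n f) * (case m' of (n, f) \<Rightarrow> delta_term N \<alpha> s n f)"
    using term_indices_neq_0
    by (cases s; cases m; cases m')
      (auto simp: delta_term_eq scale_mult power_int_add prod.distrib mult_ac)
next
  fix s s'
  assume "s \<in> F" "s' \<in> F" "s \<noteq> s'"
  then show "\<exists>m\<in>{(n, f). f \<in> sym_ratfuns N}.
      (case m of (n, f) \<Rightarrow> delta_term N \<alpha> s n f) \<noteq> (case m of (n, f) \<Rightarrow> delta_term N \<alpha> s' n f)"
    using delta_term_separation[of s N \<alpha> s'] assms(2) by fastforce
qed (use assms in \<open>auto simp: sym_ratfuns_1 delta_term_eq\<close>)

text \<open>Both expansions are rewritten over the union of their supports, where missing terms have
  coefficient 0; independence then kills the differences.\<close>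

lemma is_delta_expansion_unique:
  assumes "is_delta_expansion N \<alpha> J C" "is_delta_expansion N \<alpha> J D"
  shows "C = D"
proof (rule poly_mapping_eqI)
  fix s
  let ?F = "Poly_Mapping.keys C \<union> Poly_Mapping.keys D"
  let ?c = "\<lambda>s. Poly_Mapping.lookup C s - Poly_Mapping.lookup D s"
  have *: "J n f = (\<Sum>s\<in>?F. Poly_Mapping.lookup E s * delta_term N \<alpha> s n f)"
    if "is_delta_expansion N \<alpha> J E" "Poly_Mapping.keys E \<subseteq> ?F" "f \<in> sym_ratfuns N" for E n f
  proof -
    have "J n f = (\<Sum>s\<in>Poly_Mapping.keys E. Poly_Mapping.lookup E s * delta_term N \<alpha> s n f)"
      using that by (simp add: is_delta_expansion_def)
    also have "\<dots> = (\<Sum>s\<in>?F. Poly_Mapping.lookup E s * delta_term N \<alpha> s n f)"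
      by (rule sum.mono_neutral_left) (use that in \<open>auto simp: in_keys_iff\<close>)
    finally show ?thesis .
  qed
  have "?c s = 0" if "s \<in> ?F"
  proof (rule delta_term_independence[where F = ?F and c = ?c])
    show "(\<Sum>s\<in>?F. ?c s * delta_term N \<alpha> s n f) = 0" if "f \<in> sym_ratfuns N" for n f
      using *[OF assms(1), of f n] *[OF assms(2), of f n] that
      by (simp add: left_diff_distrib sum_subtractf)
  qed (use assms that in \<open>auto simp: is_delta_expansion_def\<close>)
  then show "Poly_Mapping.lookup C s = Poly_Mapping.lookup D s"
    by (cases "s \<in> ?F") (auto simp: in_keys_iff)
qed

text \<open>Any finite expansion over distinct terms may replace the one in the definition: where
  \<open>c s = 0\<close> the term contributes zero, whatever value R is given there. The conclusion
  holds for every f because J enters only through its expansion.\<close>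

lemma current_mult_eq:
  assumes T: "finite T" "T \<subseteq> term_indices N \<alpha>"
    and J: "\<And>n f. f \<in> sym_ratfuns N \<Longrightarrow> J n f = (\<Sum>s\<in>T. c s * delta_term N \<alpha> s n f)"
  shows "current_mult N \<alpha> R J n f =
    (\<Sum>s\<in>T. rat_subst (\<lambda>k. inverse (fst s k)) R * c s * delta_term N \<alpha> s n f)"
proof -
  define C where "C = Abs_poly_mapping (\<lambda>s. if s \<in> T then c s else 0)"
  have lookup_C: "Poly_Mapping.lookup C s = (if s \<in> T then c s else 0)" for s
    unfolding C_def by (subst lookup_Abs_poly_mapping) (auto intro: finite_subset[OF _ T(1)])
  have keys_C: "Poly_Mapping.keys C \<subseteq> T"
    by (auto simp: in_keys_iff lookup_C split: if_splits)
  have sum_C: "(\<Sum>s\<in>Poly_Mapping.keys C. h s * Poly_Mapping.lookup C s * delta_term N \<alpha> s n f) =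
      (\<Sum>s\<in>T. h s * c s * delta_term N \<alpha> s n f)" for h n f
    by (rule sum.mono_neutral_cong_left) (use T keys_C in \<open>auto simp: in_keys_iff lookup_C\<close>)
  have "is_delta_expansion N \<alpha> J C"
    using sum_C[of "\<lambda>_. 1"] J keys_C T(2) by (auto simp: is_delta_expansion_def)
  then have "(THE C. is_delta_expansion N \<alpha> J C) = C"
    using is_delta_expansion_unique by blast
  then show ?thesis
    by (simp add: current_mult_def sum_C)
qed


section \<open>Expansion of the product of currents\<close>

lemma sum_PiE_Suc:
  "(\<Sum>i\<in>{1..Suc n} \<rightarrow>\<^sub>E S. F i) = (\<Sum>i\<in>{1..n} \<rightarrow>\<^sub>E S. \<Sum>j\<in>S. F (i(Suc n := j)))"
proof -
  have "(\<Sum>i\<in>{1..Suc n} \<rightarrow>\<^sub>E S. F i) = (\<Sum>i\<in>insert (Suc n) {1..n} \<rightarrow>\<^sub>E S. F i)"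
    by (simp add: atLeastAtMostSuc_conv)
  also have "\<dots> = (\<Sum>(j, i)\<in>S \<times> ({1..n} \<rightarrow>\<^sub>E S). F (i(Suc n := j)))"
    unfolding PiE_insert_eq
    by (subst sum.reindex[OF inj_combinator]) (auto intro!: sum.cong simp: case_prod_unfold)
  also have "\<dots> = (\<Sum>j\<in>S. \<Sum>i\<in>{1..n} \<rightarrow>\<^sub>E S. F (i(Suc n := j)))"
    by (simp add: sum.cartesian_product)
  finally show ?thesis by (simp add: sum.swap[of _ S])
qed

definition point :: "(nat \<Rightarrow> nat) \<Rightarrow> nat \<Rightarrow> ratfun" where
  "point i k = qq ^ occ i (k - 1) (i k) * X (i k)"

text \<open>The coefficient of the k-th current after the earlier shifts have been moved to its
  right.\<close>

definition shifted_coeff :: "nat \<Rightarrow> (nat \<Rightarrow> nat) \<Rightarrow> nat \<Rightarrow> ratfun" where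
  "shifted_coeff N i k = scale (occ i (k - 1))
    (\<Prod>j\<in>{1..N} - {i k}. (tt * X (i k) - X j) / (X (i k) - X j))"

definition seq_index :: "nat \<Rightarrow> nat \<Rightarrow> (nat \<Rightarrow> nat) \<Rightarrow> term_index" where
  "seq_index N \<alpha> i = (restrict (point i) {1..\<alpha>}, restrict (occ i \<alpha>) {1..N})"

lemma occ_cong: "(\<And>l. l \<in> {1..k} \<Longrightarrow> i l = i' l) \<Longrightarrow> occ i k = occ i' k"
  unfolding occ_def by (intro ext arg_cong[where f = card]) auto

lemma occ_upd: "k \<le> n \<Longrightarrow> occ (i(Suc n := j)) k = occ i k"
  by (intro occ_cong) auto

lemma occ_Suc: "occ i (Suc n) = (\<lambda>l. occ i n l + (if l = i (Suc n) then 1 else 0))"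
proof
  fix l
  have "{m \<in> {1..Suc n}. i m = l} =
      (if l = i (Suc n) then insert (Suc n) {m \<in> {1..n}. i m = l} else {m \<in> {1..n}. i m = l})"
    by (auto simp: le_Suc_eq)
  then show "occ i (Suc n) l = occ i n l + (if l = i (Suc n) then 1 else 0)"
    by (simp add: occ_def)
qed

text \<open>The new current acts first and so lies inside the earlier shifts. These scale its
  variable and its coefficient, which gives the entries of the longer sequence at its last
  position.\<close>

lemma m_prod_expand:
  "m_prod N \<alpha> n f = (\<Sum>i\<in>{1..\<alpha>} \<rightarrow>\<^sub>E {1..N}.
    (\<Prod>k\<in>{1..\<alpha>}. point i k powi n k * shifted_coeff N i k) * scale (occ i \<alpha>) f)"
  unfolding m_prod_def
proof (induction \<alpha> arbitrary: f)
  case 0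
  have "occ i 0 = (\<lambda>_. 0)" for i by (simp add: occ_def fun_eq_iff)
  then show ?case by (simp add: scale_0)
next
  case (Suc \<alpha>)
  let ?Q = "\<lambda>i a. \<Prod>k\<in>{1..a}. point i k powi n k * shifted_coeff N i k"
  have step: "?Q i \<alpha> * scale (occ i \<alpha>) (X j powi n (Suc \<alpha>) *
        (\<Prod>l\<in>{1..N} - {j}. (tt * X j - X l) / (X j - X l)) * shift j f) =
      ?Q (i(Suc \<alpha> := j)) (Suc \<alpha>) * scale (occ (i(Suc \<alpha> := j)) (Suc \<alpha>)) f" for i j
  proof -
    let ?i = "i(Suc \<alpha> := j)"
    \<comment> \<open>The entry at k depends only on positions up to k, so appending j changes none
      of them.\<close>
    have "?Q ?i \<alpha> = ?Q i \<alpha>"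
      by (intro prod.cong refl) (auto simp: point_def shifted_coeff_def occ_upd)
    moreover have "?Q ?i (Suc \<alpha>) = ?Q ?i \<alpha> *
        (point ?i (Suc \<alpha>) powi n (Suc \<alpha>) * shifted_coeff N ?i (Suc \<alpha>))"
      by (simp add: prod.nat_ivl_Suc')
    moreover have "scale (occ ?i (Suc \<alpha>)) f = scale (occ i \<alpha>) (shift j f)"
      by (simp add: shift_eq_scale scale_scale occ_Suc occ_upd)
    moreover have "point ?i (Suc \<alpha>) = scale (occ i \<alpha>) (X j)"
      by (simp add: point_def occ_upd)
    moreover have "shifted_coeff N ?i (Suc \<alpha>) =
        scale (occ i \<alpha>) (\<Prod>l\<in>{1..N} - {j}. (tt * X j - X l) / (X j - X l))"
      by (simp add: shifted_coeff_def occ_upd)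
    ultimately show ?thesis
      by (simp only: scale_mult scale_powi mult.assoc)
  qed
  have "op_prod (Suc \<alpha>) (\<lambda>k. m_coeff N (n k)) f =
      (\<Sum>i\<in>{1..\<alpha>} \<rightarrow>\<^sub>E {1..N}. ?Q i \<alpha> * scale (occ i \<alpha>) (m_coeff N (n (Suc \<alpha>)) f))"
    by (simp only: op_prod_Suc comp_apply Suc.IH)
  also have "\<dots> = (\<Sum>i\<in>{1..\<alpha>} \<rightarrow>\<^sub>E {1..N}. \<Sum>j\<in>{1..N}.
      ?Q (i(Suc \<alpha> := j)) (Suc \<alpha>) * scale (occ (i(Suc \<alpha> := j)) (Suc \<alpha>)) f)"
    by (simp only: m_coeff_def scale_sum sum_distrib_left step)
  finally show ?case by (simp only: sum_PiE_Suc)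
qed

lemma point_eq_const: "point i k = const (qc ^ occ i (k - 1) (i k)) * X (i k)"
  by (simp add: point_def qq_eq_const const_power)

lemma seq_index_in_term_indices:
  assumes "i \<in> {1..\<alpha>} \<rightarrow>\<^sub>E {1..N}"
  shows "seq_index N \<alpha> i \<in> term_indices N \<alpha>"
proof -
  have "point i k \<in> {qq powi a * X j | a j. j \<in> {1..N}}" if "k \<in> {1..\<alpha>}" for k
  proof -
    have "i k \<in> {1..N}" using assms that by auto
    moreover have "point i k = qq powi int (occ i (k - 1) (i k)) * X (i k)"
      by (simp add: point_def)
    ultimately show ?thesis by blast
  qed
  then show ?thesis
    by (auto simp: seq_index_def term_indices_def)
qed

text \<open>The variable in \<open>point i k\<close> reveals \<open>i k\<close>. Distinct sequences
  therefore give distinct delta terms, and no coefficients have to be collected.\<close>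

lemma inj_on_seq_index: "inj_on (seq_index N \<alpha>) ({1..\<alpha>} \<rightarrow>\<^sub>E {1..N})"
proof (rule inj_onI)
  fix i i' assume i: "i \<in> {1..\<alpha>} \<rightarrow>\<^sub>E {1..N}" "i' \<in> {1..\<alpha>} \<rightarrow>\<^sub>E {1..N}"
    and eq: "seq_index N \<alpha> i = seq_index N \<alpha> i'"
  show "i = i'"
  proof (rule PiE_ext[OF i])
    fix k assume k: "k \<in> {1..\<alpha>}"
    from eq have "restrict (point i) {1..\<alpha>} = restrict (point i') {1..\<alpha>}"
      by (simp add: seq_index_def)
    from fun_cong[OF this, of k] k have "point i k = point i' k" by simp
    then show "i k = i' k" by (simp add: point_eq_const const_X_eq_iff)
  qed
qed

lemma delta_term_seq_index:
  assumes "i \<in> {1..\<alpha>} \<rightarrow>\<^sub>E {1..N}"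
  shows "delta_term N \<alpha> (seq_index N \<alpha> i) n f =
    (\<Prod>k\<in>{1..\<alpha>}. point i k powi n k) * scale (occ i \<alpha>) f"
proof -
  have "occ i \<alpha> j = 0" if "j \<notin> {1..N}" for j
    using assms that by (auto simp: occ_def)
  then have "(\<lambda>j. if j \<in> {1..N} then restrict (occ i \<alpha>) {1..N} j else 0) = occ i \<alpha>"
    by (auto simp: fun_eq_iff)
  then show ?thesis by (simp add: seq_index_def delta_term_eq cong: if_cong)
qed

lemma m_prod_delta_terms:
  "m_prod N \<alpha> n f = (\<Sum>i\<in>{1..\<alpha>} \<rightarrow>\<^sub>E {1..N}.
    (\<Prod>k\<in>{1..\<alpha>}. shifted_coeff N i k) * delta_term N \<alpha> (seq_index N \<alpha> i) n f)"
  unfolding m_prod_expand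
  by (intro sum.cong refl) (simp add: delta_term_seq_index prod.distrib mult_ac)

text \<open>The result has the shape of the hypothesis with \<open>c i\<close> multiplied by a value
  of R, so the lemma applies first to the kernel and then to P.\<close>

lemma current_mult_seq:
  assumes "\<And>n f. f \<in> sym_ratfuns N \<Longrightarrow>
    J n f = (\<Sum>i\<in>{1..\<alpha>} \<rightarrow>\<^sub>E {1..N}. c i * delta_term N \<alpha> (seq_index N \<alpha> i) n f)"
  shows "current_mult N \<alpha> R J n f = (\<Sum>i\<in>{1..\<alpha>} \<rightarrow>\<^sub>E {1..N}.
    rat_subst (\<lambda>k. inverse (restrict (point i) {1..\<alpha>} k)) R * c i *
      delta_term N \<alpha> (seq_index N \<alpha> i) n f)"
proof -
  define I where "I = {1..\<alpha>} \<rightarrow>\<^sub>E {1..N}"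
  \<comment> \<open>Recovering the sequence from its term turns coefficients attached to sequences
    into coefficients attached to terms.\<close>
  let ?inv = "inv_into I (seq_index N \<alpha>)"
  have inj: "inj_on (seq_index N \<alpha>) I"
    using inj_on_seq_index by (simp only: I_def)
  have "J n f = (\<Sum>s\<in>seq_index N \<alpha> ` I. c (?inv s) * delta_term N \<alpha> s n f)"
    if "f \<in> sym_ratfuns N" for n f
    using assms[OF that, folded I_def] by (simp add: sum.reindex[OF inj] inv_into_f_f[OF inj])
  moreover have "finite I" by (simp add: I_def finite_PiE)
  moreover have "seq_index N \<alpha> ` I \<subseteq> term_indices N \<alpha>"
    unfolding I_def using seq_index_in_term_indices by blast
  ultimately have "current_mult N \<alpha> R J n f = (\<Sum>s\<in>seq_index N \<alpha> ` I.
      rat_subst (\<lambda>k. inverse (fst s k)) R * c (?inv s) * delta_term N \<alpha> s n f)"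
    by (intro current_mult_eq) auto
  then show ?thesis
    unfolding I_def[symmetric]
    by (simp add: sum.reindex[OF inj] inv_into_f_f[OF inj]) (simp add: seq_index_def)
qed


section \<open>Values of the kernel\<close>

definition kernel_value :: "nat \<Rightarrow> (nat \<Rightarrow> ratfun) \<Rightarrow> ratfun" where
  "kernel_value \<alpha> u = (\<Prod>i\<in>{1..\<alpha>}. \<Prod>j\<in>{i<..\<alpha>}.
      ((u i - u j) * (u i - qq * u j)) / ((u i - tt * u j) * (tt * u i - qq * u j)))"

lemma point_neq_0 [simp]: "point i k \<noteq> 0"
  by (simp add: point_def)

text \<open>Points are powers of q times variables, which a factor t can never match. With u inverse
  to the points, this and the next lemma say that neither factor of a kernel denominator
  vanishes.\<close>

lemma point_neq_tt_point: "point i l \<noteq> tt * point i k"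
  using const_X_eq_iff[of "tc * qc ^ occ i (k - 1) (i k)"] tc_qc_power_neq
  by (simp add: point_eq_const tt_eq_const flip: mult.assoc) (metis tc_qc_power_neq)

lemma tt_point_neq_qq_point: "tt * point i l \<noteq> qq * point i k"
proof -
  have "const (tc * qc ^ m) * X a \<noteq> const (qc ^ Suc n) * X b" for m n a b
    using tc_qc_power_neq[of m "Suc n"] by (simp add: const_X_eq_iff del: power_Suc const_simps)
  then show ?thesis
    by (simp add: point_eq_const tt_eq_const qq_eq_const mult.assoc)
qed

text \<open>The kernel is regular at every sequence, with or without repetitions, so direct
  substitution gives its value.\<close>

lemma rat_subst_kernel:
  assumes u: "\<And>k. k \<in> {1..\<alpha>} \<Longrightarrow> u k = inverse (point i k)"
  shows "rat_subst u (kernel \<alpha>) = kernel_value \<alpha> u"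
proof -
  have "u k - tt * u l \<noteq> 0" "tt * u k - qq * u l \<noteq> 0" if "k \<in> {1..\<alpha>}" "l \<in> {k<..\<alpha>}" for k l
    using that point_neq_tt_point[of i l k] tt_point_neq_qq_point[of i l k]
    by (simp_all add: u field_simps)
  then show ?thesis
    unfolding kernel_def kernel_value_def by (intro rat_subst_eqI evals_intros) auto
qed

text \<open>At two consecutive occurrences k, l of the same index, \<open>u\<^sub>k = q u\<^sub>l\<close>.\<close>

lemma kernel_value_eq_0:
  assumes u: "\<And>k. k \<in> {1..\<alpha>} \<Longrightarrow> u k = inverse (point i k)"
    and "\<not> inj_on i {1..\<alpha>}"
  shows "kernel_value \<alpha> u = 0"
proof -
  from assms(2) obtain k l0 where k: "k \<in> {1..\<alpha>}" and l0: "l0 \<in> {1..\<alpha>}" "k < l0" "i l0 = i k"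
    unfolding inj_on_def by (metis linorder_neqE_nat)
  \<comment> \<open>The least later occurrence makes k and l consecutive; a farther pair would
    differ by a higher power of q.\<close>
  define l where "l = (LEAST l. k < l \<and> i l = i k)"
  have l: "k < l" "i l = i k" and "l \<le> l0"
    using LeastI[of "\<lambda>l. k < l \<and> i l = i k" l0] Least_le[of "\<lambda>l. k < l \<and> i l = i k" l0] l0
    by (auto simp: l_def)
  have between: "i m \<noteq> i k" if "k < m" "m < l" for m
    using not_less_Least[of m "\<lambda>l. k < l \<and> i l = i k"] that by (auto simp: l_def)
  have l\<alpha>: "l \<in> {1..\<alpha>}" using l k l0 \<open>l \<le> l0\<close> by auto
  have "{m \<in> {1..l - 1}. i m = i l} = insert k {m \<in> {1..k - 1}. i m = i k}" (is "?L = ?R")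
  proof
    show "?L \<subseteq> ?R"
    proof
      fix m assume m: "m \<in> ?L"
      then have "\<not> (k < m \<and> m < l)" using between l by auto
      with m l show "m \<in> ?R" by auto
    qed
    show "?R \<subseteq> ?L" using k l by auto
  qed
  moreover have "card (insert k {m \<in> {1..k - 1}. i m = i k}) = Suc (card {m \<in> {1..k - 1}. i m = i k})"
    by (rule card_insert_disjoint) (use k in auto)
  ultimately have "occ i (l - 1) (i l) = Suc (occ i (k - 1) (i k))"
    by (simp only: occ_def)
  then have "point i l = qq * point i k" by (simp add: point_def l)
  then have "u k - qq * u l = 0" by (simp add: u[OF k] u[OF l\<alpha>])
  then have "(\<Prod>j\<in>{k<..\<alpha>}. ((u k - u j) * (u k - qq * u j)) /
      ((u k - tt * u j) * (tt * u k - qq * u j))) = 0"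
    using l l\<alpha> by (intro prod_zero bexI[of _ l]) auto
  with k show ?thesis
    unfolding kernel_value_def by (intro prod_zero[OF finite_atLeastAtMost] bexI[of _ k])
qed

text \<open>Renaming variables along an injection can be undone by renaming back.\<close>

lemma pol_subst_inj_nonzero:
  assumes "b \<noteq> 0" "pol_vars b \<subseteq> V" "inj_on i V"
  shows "pol_subst (\<lambda>k. X (i k)) b \<noteq> 0"
proof (rule pol_subst_nonzero[OF assms(1)])
  fix k assume "k \<in> pol_vars b"
  with assms have "inv_into V i (i k) = k" by auto
  then show "evals (\<lambda>m. X (inv_into V i m)) (X (i k)) (X k)"
    by (metis evals_X)
qed

section \<open>Sequences without repeated indices\<close>

context
  fixes i :: "nat \<Rightarrow> nat" and \<alpha> N :: nat
  assumes i: "i \<in> {1..\<alpha>} \<rightarrow> {1..N}" and inj: "inj_on i {1..\<alpha>}"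
begin

lemmas i_eq = inj_on_eq_iff[OF inj]

lemma occ_inj:
  assumes "k \<le> \<alpha>"
  shows "occ i k j = (if j \<in> i ` {1..k} then 1 else 0)"
proof (cases "j \<in> i ` {1..k}")
  case True
  then obtain m where m: "m \<in> {1..k}" "j = i m" by auto
  then have "{l \<in> {1..k}. i l = j} = {m}"
    using assms by (auto simp: i_eq)
  with True show ?thesis by (simp add: occ_def)
next
  case False
  then have "{l \<in> {1..k}. i l = j} = {}" by auto
  with False show ?thesis by (simp only: occ_def) simp
qed

lemma point_inj:
  assumes "k \<in> {1..\<alpha>}"
  shows "point i k = X (i k)"
proof -
  have "i k \<notin> i ` {1..k - 1}" using assms by (auto simp: i_eq)
  with assms show ?thesis by (auto simp: point_def occ_inj)
qed

text \<open>The indices other than \<open>i k\<close> fall into three groups: earlier entries,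
  shifted once and hence carrying q; later entries, not yet shifted; and indices outside the
  sequence.\<close>

lemma shifted_coeff_inj:
  assumes k: "k \<in> {1..\<alpha>}"
  shows "shifted_coeff N i k =
    (\<Prod>l\<in>{1..<k}. (tt * X (i k) - qq * X (i l)) / (X (i k) - qq * X (i l))) *
    (\<Prod>l\<in>{k<..\<alpha>}. (tt * X (i k) - X (i l)) / (X (i k) - X (i l))) *
    (\<Prod>j\<in>{1..N} - i ` {1..\<alpha>}. (tt * X (i k) - X j) / (X (i k) - X j))"
proof -
  let ?F = "\<lambda>j. (tt * X (i k) - qq ^ occ i (k - 1) j * X j) /
      (X (i k) - qq ^ occ i (k - 1) j * X j)"
  have occ_k: "occ i (k - 1) (i k) = 0"
    using k by (cases k) (auto simp: occ_inj i_eq)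
  have "shifted_coeff N i k = (\<Prod>j\<in>{1..N} - {i k}. ?F j)"
    by (simp add: shifted_coeff_def scale_prod scale_divide scale_diff scale_mult occ_k[unfolded One_nat_def])
  also have "{1..N} - {i k} = i ` {1..<k} \<union> i ` {k<..\<alpha>} \<union> ({1..N} - i ` {1..\<alpha>})" (is "?L = ?R")
  proof
    show "?L \<subseteq> ?R"
    proof
      fix j assume j: "j \<in> ?L"
      show "j \<in> ?R"
      proof (cases "j \<in> i ` {1..\<alpha>}")
        case True
        then obtain l where l: "l \<in> {1..\<alpha>}" "j = i l" by auto
        with j have "l \<noteq> k" by auto
        with l show ?thesis by (cases "l < k") auto
      qed (use j in auto)
    qed
    show "?R \<subseteq> ?L" using i k by (auto simp: i_eq Pi_iff)
  qed
  also have "(\<Prod>j\<in>?R. ?F j) =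
      (\<Prod>j\<in>i ` {1..<k}. ?F j) * (\<Prod>j\<in>i ` {k<..\<alpha>}. ?F j) * (\<Prod>j\<in>{1..N} - i ` {1..\<alpha>}. ?F j)"
  proof -
    have "i ` {1..<k} \<inter> i ` {k<..\<alpha>} = {}"
      using k by (auto simp: i_eq)
    moreover have "(i ` {1..<k} \<union> i ` {k<..\<alpha>}) \<inter> ({1..N} - i ` {1..\<alpha>}) = {}"
      using k by auto
    ultimately show ?thesis by (simp add: prod.union_disjoint)
  qed
  also have "(\<Prod>j\<in>i ` {1..<k}. ?F j) =
      (\<Prod>l\<in>{1..<k}. (tt * X (i k) - qq * X (i l)) / (X (i k) - qq * X (i l)))"
  proof -
    have "occ i (k - 1) (i l) = 1" if "l \<in> {1..<k}" for l
      using that k by (auto simp: occ_inj)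
    then show ?thesis using k
      by (subst prod.reindex) (auto intro!: prod.cong inj_on_subset[OF inj])
  qed
  also have "(\<Prod>j\<in>i ` {k<..\<alpha>}. ?F j) =
      (\<Prod>l\<in>{k<..\<alpha>}. (tt * X (i k) - X (i l)) / (X (i k) - X (i l)))"
  proof -
    have "occ i (k - 1) (i l) = 0" if "l \<in> {k<..\<alpha>}" for l
      using that k by (cases k) (auto simp: occ_inj i_eq)
    then show ?thesis using k
      by (subst prod.reindex) (auto intro!: prod.cong inj_on_subset[OF inj])
  qed
  also have "(\<Prod>j\<in>{1..N} - i ` {1..\<alpha>}. ?F j) =
      (\<Prod>j\<in>{1..N} - i ` {1..\<alpha>}. (tt * X (i k) - X j) / (X (i k) - X j))"
  proof -
    have "occ i (k - 1) j = 0" if "j \<in> {1..N} - i ` {1..\<alpha>}" for j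
      using that k by (auto simp: occ_inj)
    then show ?thesis by (intro prod.cong) auto
  qed
  finally show ?thesis .
qed

text \<open>A pair k < l meets three factors: \<open>K k l\<close> from the kernel,
  \<open>A k l\<close> from coefficient k, where l is still unshifted, and \<open>B l k\<close> from
  coefficient l, where k is already shifted. Their product is 1.\<close>

lemma kernel_cancels:
  assumes u: "\<And>k. k \<in> {1..\<alpha>} \<Longrightarrow> u k = inverse (point i k)"
  shows "kernel_value \<alpha> u * (\<Prod>k\<in>{1..\<alpha>}. shifted_coeff N i k) =
    (\<Prod>k\<in>{1..\<alpha>}. \<Prod>j\<in>{1..N} - i ` {1..\<alpha>}. (tt * X (i k) - X j) / (X (i k) - X j))"
proof -
  define B where "B k l = (tt * X (i k) - qq * X (i l)) / (X (i k) - qq * X (i l))" for k l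
  define A where "A k l = (tt * X (i k) - X (i l)) / (X (i k) - X (i l))" for k l
  define K where "K k l = ((u k - u l) * (u k - qq * u l)) /
      ((u k - tt * u l) * (tt * u k - qq * u l))" for k l
  define R where "R k = (\<Prod>j\<in>{1..N} - i ` {1..\<alpha>}. (tt * X (i k) - X j) / (X (i k) - X j))" for k
  have pair: "K k l * B l k * A k l = 1" if "k \<in> {1..\<alpha>}" "l \<in> {k<..\<alpha>}" for k l
  proof -
    have kl: "i k \<noteq> i l" "l \<in> {1..\<alpha>}" using that by (auto simp: i_eq)
    define a where "a = X (i k)"
    define b where "b = X (i l)"
    have ab: "u k = inverse a" "u l = inverse b"
      using that kl by (simp_all add: u point_inj a_def b_def)
    have 0: "a \<noteq> 0" "b \<noteq> 0" "a \<noteq> b" using kl by (auto simp: a_def b_def)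
    have 1: "b \<noteq> tt * a" "tt * b \<noteq> qq * a"
      using point_neq_tt_point[of i l k] tt_point_neq_qq_point[of i l k] that kl
      by (simp_all add: point_inj a_def b_def)
    have 2: "b \<noteq> qq * a"
      using const_X_eq_iff[of 1 "i l" qc "i k"] kl by (auto simp: a_def b_def qq_eq_const)
    have "K k l = ((b - a) * (b - qq * a)) / ((b - tt * a) * (tt * b - qq * a))"
    proof -
      have inv: "inverse a - c * inverse b = (b - c * a) / (a * b)"
        "tt * inverse a - c * inverse b = (tt * b - c * a) / (a * b)" for c
        using 0 by (simp_all add: field_simps)
      show ?thesis
        using 0 inv(1)[of 1] by (simp add: K_def ab inv)
    qed
    then show ?thesis
      using 0 1 2 by (simp add: A_def B_def flip: a_def b_def) (simp add: divide_simps, simp add: algebra_simps)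
  qed
  \<comment> \<open>The shifted factors are listed at the later position of each pair; exchanging
    the products lists them at the earlier one, as for K and A.\<close>
  have "(\<Prod>k\<in>{1..\<alpha>}. \<Prod>l\<in>{1..<k}. B k l) =
      (\<Prod>k\<in>{1..\<alpha>}. \<Prod>l\<in>{l \<in> {1..\<alpha>}. l < k}. B k l)"
    by (intro prod.cong) auto
  also have "\<dots> = (\<Prod>l\<in>{1..\<alpha>}. \<Prod>k\<in>{k \<in> {1..\<alpha>}. l < k}. B k l)"
    by (rule prod.swap_restrict) auto
  also have "\<dots> = (\<Prod>k\<in>{1..\<alpha>}. \<Prod>l\<in>{k<..\<alpha>}. B l k)"
    by (intro prod.cong) auto
  finally have swap: "(\<Prod>k\<in>{1..\<alpha>}. \<Prod>l\<in>{1..<k}. B k l) = \<dots>" .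
  have "(\<Prod>k\<in>{1..\<alpha>}. shifted_coeff N i k) =
      (\<Prod>k\<in>{1..\<alpha>}. (\<Prod>l\<in>{1..<k}. B k l) * (\<Prod>l\<in>{k<..\<alpha>}. A k l) * R k)"
    by (intro prod.cong refl) (simp add: shifted_coeff_inj A_def B_def R_def)
  then have "kernel_value \<alpha> u * (\<Prod>k\<in>{1..\<alpha>}. shifted_coeff N i k) =
      (\<Prod>k\<in>{1..\<alpha>}. \<Prod>l\<in>{k<..\<alpha>}. K k l * B l k * A k l) * (\<Prod>k\<in>{1..\<alpha>}. R k)"
    by (simp only: kernel_value_def K_def[symmetric] prod.distrib swap mult.assoc)
  also have "(\<Prod>k\<in>{1..\<alpha>}. \<Prod>l\<in>{k<..\<alpha>}. K k l * B l k * A k l) = 1"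
    using pair by (intro prod.neutral ballI) auto
  finally show ?thesis by (simp add: R_def)
qed

text \<open>The two inversions cancel and leave \<open>X (i k)\<close>. P has a denominator in the
  first \<alpha> variables, whose image is nonzero because i is injective.\<close>

lemma rat_subst_inverse:
  assumes "P \<in> sym_ratfuns \<alpha>" "\<And>k. k \<in> {1..\<alpha>} \<Longrightarrow> u k = inverse (point i k)"
  shows "rat_subst u (rat_subst (\<lambda>k. inverse (X k)) P) = rat_subst (\<lambda>k. X (i k)) P"
proof -
  from assms(1) obtain a b where ab: "b \<noteq> 0" "pol_vars a \<subseteq> {1..\<alpha>}" "pol_vars b \<subseteq> {1..\<alpha>}"
    "P = Fract a b" by (auto simp: sym_ratfuns_def)
  have "evals u (inverse (X k)) (X (i k))" if "k \<in> {1..\<alpha>}" for k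
    using evals_inverse[OF evals_X, of u k] that by (simp add: assms(2) point_inj)
  then show ?thesis unfolding ab(4)
    using ab inj
    by (intro rat_subst_eqI evals_rat_subst[where V = "{1..\<alpha>}"] pol_subst_inj_nonzero)
qed

end

text \<open>A representation of P in the first \<alpha> variables sees only the values on
  1..\<alpha>, and injectivity makes both substitutions regular there.\<close>

lemma rat_subst_inj_cong:
  assumes "P \<in> sym_ratfuns \<alpha>" "inj_on i {1..\<alpha>}" "\<And>k. k \<in> {1..\<alpha>} \<Longrightarrow> i k = i' k"
  shows "rat_subst (\<lambda>k. X (i' k)) P = rat_subst (\<lambda>k. X (i k)) P"
proof -
  from assms(1) obtain a b where ab: "b \<noteq> 0" "pol_vars a \<subseteq> {1..\<alpha>}" "pol_vars b \<subseteq> {1..\<alpha>}"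
    "P = Fract a b" by (auto simp: sym_ratfuns_def)
  have *: "pol_subst (\<lambda>k. X (i' k)) p = pol_subst (\<lambda>k. X (i k)) p" if "pol_vars p \<subseteq> {1..\<alpha>}" for p
    using that assms(3) by (intro pol_subst_cong) auto
  have nz: "pol_subst (\<lambda>k. X (i k)) b \<noteq> 0"
    using assms(2) ab by (intro pol_subst_inj_nonzero)
  show ?thesis
    using nz unfolding ab(4) by (subst (1 2) rat_subst_eqI[OF evalsI]) (use ab in \<open>auto simp: *\<close>)
qed


section \<open>Extensions of an injection to a permutation\<close>

text \<open>One extension \<open>\<tau>\<close> is fixed; the extensions are exactly
  \<open>\<tau>\<close> composed with the permutations of the positions beyond \<alpha>.\<close>

lemma card_permutes_restrict:
  assumes "\<alpha> \<le> N" "i \<in> {1..\<alpha>} \<rightarrow>\<^sub>E {1..N}" "inj_on i {1..\<alpha>}"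
  shows "card {\<sigma>. \<sigma> permutes {1..N} \<and> restrict \<sigma> {1..\<alpha>} = i} = fact (N - \<alpha>)"
proof -
  have img: "i ` {1..\<alpha>} \<subseteq> {1..N}" using assms(2) by auto
  have "card ({1..N} - i ` {1..\<alpha>}) = card {\<alpha><..N}"
    using img assms by (simp add: card_Diff_subset card_image)
  then obtain e where e: "bij_betw e {\<alpha><..N} ({1..N} - i ` {1..\<alpha>})"
    by (metis finite_Diff finite_atLeastAtMost finite_greaterThanAtMost finite_same_card_bij)
  define \<tau> where "\<tau> x = (if x \<in> {1..\<alpha>} then i x else if x \<in> {\<alpha><..N} then e x else x)" for x
  have "bij_betw \<tau> {1..\<alpha>} (i ` {1..\<alpha>})"
    using assms(3) by (subst bij_betw_cong[where g = i]) (auto simp: \<tau>_def inj_on_imp_bij_betw)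
  moreover have "bij_betw \<tau> {\<alpha><..N} ({1..N} - i ` {1..\<alpha>})"
    using e by (subst bij_betw_cong[where g = e]) (auto simp: \<tau>_def)
  ultimately have "bij_betw \<tau> ({1..\<alpha>} \<union> {\<alpha><..N}) (i ` {1..\<alpha>} \<union> ({1..N} - i ` {1..\<alpha>}))"
    by (rule bij_betw_combine) auto
  moreover have "{1..\<alpha>} \<union> {\<alpha><..N} = {1..N}" using assms(1) by auto
  moreover have "i ` {1..\<alpha>} \<union> ({1..N} - i ` {1..\<alpha>}) = {1..N}" using img by auto
  ultimately have "bij_betw \<tau> {1..N} {1..N}" by simp
  then have \<tau>: "\<tau> permutes {1..N}"
    by (rule bij_imp_permutes) (use assms(1) in \<open>auto simp: \<tau>_def\<close>)
  have \<tau>i: "\<tau> x = i x" if "x \<in> {1..\<alpha>}" for x using that by (simp add: \<tau>_def)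
  have "{\<sigma>. \<sigma> permutes {1..N} \<and> restrict \<sigma> {1..\<alpha>} = i} = (\<lambda>\<pi>. \<tau> \<circ> \<pi>) ` {\<pi>. \<pi> permutes {\<alpha><..N}}"
    (is "?L = ?R")
  proof
    show "?L \<subseteq> ?R"
    proof
      fix \<sigma> assume "\<sigma> \<in> ?L"
      then have \<sigma>: "\<sigma> permutes {1..N}" "\<And>x. x \<in> {1..\<alpha>} \<Longrightarrow> \<sigma> x = i x" by auto
      have "inv \<tau> \<circ> \<sigma> permutes {1..N}"
        using \<sigma>(1) \<tau> by (intro permutes_compose permutes_inv)
      then have "inv \<tau> \<circ> \<sigma> permutes {\<alpha><..N}"
      proof (rule permutes_superset)
        fix x assume "x \<in> {1..N} - {\<alpha><..N}"
        then have "x \<in> {1..\<alpha>}" by auto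
        then show "(inv \<tau> \<circ> \<sigma>) x = x"
          using \<sigma>(2) \<tau>i permutes_inverses(2)[OF \<tau>] by (metis comp_apply)
      qed
      moreover have "\<sigma> = \<tau> \<circ> (inv \<tau> \<circ> \<sigma>)"
        using permutes_inverses(1)[OF \<tau>] by (simp add: fun_eq_iff)
      ultimately show "\<sigma> \<in> ?R" by blast
    qed
    show "?R \<subseteq> ?L"
    proof
      fix \<sigma> assume "\<sigma> \<in> ?R"
      then obtain \<pi> where \<pi>: "\<pi> permutes {\<alpha><..N}" "\<sigma> = \<tau> \<circ> \<pi>" by auto
      from \<pi>(1) have "\<pi> permutes {1..N}" by (rule permutes_subset) auto
      then have "\<sigma> permutes {1..N}" using \<tau> \<pi>(2) by (simp add: permutes_compose)
      moreover have "\<pi> x = x" if "x \<in> {1..\<alpha>}" for x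
        using that by (intro permutes_not_in[OF \<pi>(1)]) auto
      then have "restrict \<sigma> {1..\<alpha>} = i"
        using assms(2) \<tau>i \<pi>(2) by (intro ext) (auto simp: restrict_def PiE_iff extensional_def)
      ultimately show "\<sigma> \<in> ?L" by simp
    qed
  qed
  moreover have "inj_on (\<lambda>\<pi>. \<tau> \<circ> \<pi>) {\<pi>. \<pi> permutes {\<alpha><..N}}"
    by (rule inj_onI) (metis fun.inj_map_strong permutes_inj[OF \<tau>] injD comp_apply ext)
  ultimately show ?thesis
    using card_permutations[of "{\<alpha><..N}" "N - \<alpha>"] by (simp add: card_image)
qed

text \<open>The permutations are grouped into the fibres of restriction, all of the same
  size.\<close>

lemma sum_permutes_restrict:
  fixes G :: "(nat \<Rightarrow> nat) \<Rightarrow> ratfun"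
  assumes "\<alpha> \<le> N"
  shows "(\<Sum>\<sigma> | \<sigma> permutes {1..N}. G (restrict \<sigma> {1..\<alpha>})) =
    of_nat (fact (N - \<alpha>)) * (\<Sum>i | i \<in> {1..\<alpha>} \<rightarrow>\<^sub>E {1..N} \<and> inj_on i {1..\<alpha>}. G i)"
proof -
  let ?S = "{\<sigma>. \<sigma> permutes {1..N}}"
  let ?T = "{i. i \<in> {1..\<alpha>} \<rightarrow>\<^sub>E {1..N} \<and> inj_on i {1..\<alpha>}}"
  have "(\<lambda>\<sigma>. restrict \<sigma> {1..\<alpha>}) ` ?S \<subseteq> ?T"
  proof (intro subsetI, elim imageE CollectE)
    fix i \<sigma> assume i: "i = restrict \<sigma> {1..\<alpha>}" and \<sigma>: "\<sigma> permutes {1..N}"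
    have "\<sigma> x \<in> {1..N}" if "x \<in> {1..\<alpha>}" for x
      using permutes_in_image[OF \<sigma>, of x] that assms by simp
    then show "i \<in> ?T"
      using i by (auto intro: inj_on_subset[OF permutes_inj[OF \<sigma>]])
  qed
  moreover have "finite ?T"
    by (rule finite_subset[of _ "{1..\<alpha>} \<rightarrow>\<^sub>E {1..N}"]) (auto intro: finite_PiE)
  ultimately have "(\<Sum>\<sigma>\<in>?S. G (restrict \<sigma> {1..\<alpha>})) =
      (\<Sum>i\<in>?T. \<Sum>\<sigma>\<in>{\<sigma> \<in> ?S. restrict \<sigma> {1..\<alpha>} = i}. G (restrict \<sigma> {1..\<alpha>}))"
    by (intro sum.group[symmetric]) (auto simp: finite_permutations)
  also have "\<dots> = (\<Sum>i\<in>?T. of_nat (card {\<sigma>. \<sigma> permutes {1..N} \<and> restrict \<sigma> {1..\<alpha>} = i}) * G i)"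
    by (intro sum.cong refl) simp
  also have "\<dots> = (\<Sum>i\<in>?T. of_nat (fact (N - \<alpha>)) * G i)"
    by (intro sum.cong refl, elim CollectE conjE) (simp only: card_permutes_restrict[OF assms])
  finally show ?thesis by (simp add: sum_distrib_left)
qed


section \<open>Comparison of the two operators\<close>

text \<open>The summand common to both operators after reduction to injective sequences.\<close>

definition injection_term :: "nat \<Rightarrow> nat \<Rightarrow> ratfun \<Rightarrow> ratfun \<Rightarrow> (nat \<Rightarrow> nat) \<Rightarrow> ratfun" where
  "injection_term N \<alpha> P f i = rat_subst (\<lambda>k. X (i k)) P *
    (\<Prod>k\<in>{1..\<alpha>}. \<Prod>j\<in>{1..N} - i ` {1..\<alpha>}. (tt * X (i k) - X j) / (X (i k) - X j)) *
    scale (occ i \<alpha>) f"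

lemma M_op_eq_sum_injections:
  assumes "P \<in> sym_ratfuns \<alpha>"
  shows "M_op N \<alpha> P f = 1 / of_nat (fact \<alpha>) *
    (\<Sum>i | i \<in> {1..\<alpha>} \<rightarrow>\<^sub>E {1..N} \<and> inj_on i {1..\<alpha>}. injection_term N \<alpha> P f i)"
proof -
  let ?I = "{1..\<alpha>} \<rightarrow>\<^sub>E {1..N}"
  let ?u = "\<lambda>i k. inverse (restrict (point i) {1..\<alpha>} k)"
  let ?Q = "rat_subst (\<lambda>k. inverse (X k)) P"
  let ?c = "\<lambda>i. rat_subst (?u i) (kernel \<alpha>) * (\<Prod>k\<in>{1..\<alpha>}. shifted_coeff N i k)"
  have c: "?c i = (if inj_on i {1..\<alpha>} then
      \<Prod>k\<in>{1..\<alpha>}. \<Prod>j\<in>{1..N} - i ` {1..\<alpha>}. (tt * X (i k) - X j) / (X (i k) - X j) else 0)"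
    if "i \<in> ?I" for i
  proof -
    have u: "?u i k = inverse (point i k)" if "k \<in> {1..\<alpha>}" for k using that by simp
    have "i \<in> {1..\<alpha>} \<rightarrow> {1..N}" using that by (simp add: PiE_def)
    then show ?thesis
      using rat_subst_kernel[OF u] kernel_value_eq_0[OF u] kernel_cancels[OF _ _ u] by simp
  qed
  have "CT (current_mult N \<alpha> ?Q (current_mult N \<alpha> (kernel \<alpha>) (m_prod N \<alpha>))) f =
      (\<Sum>i\<in>?I. rat_subst (?u i) ?Q * ?c i * delta_term N \<alpha> (seq_index N \<alpha> i) (\<lambda>_. 0) f)"
    unfolding CT_def by (intro current_mult_seq m_prod_delta_terms)
  also have "\<dots> = (\<Sum>i | i \<in> ?I \<and> inj_on i {1..\<alpha>}. injection_term N \<alpha> P f i)"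
  proof (rule sum.mono_neutral_cong_right)
    fix i assume "i \<in> {i. i \<in> ?I \<and> inj_on i {1..\<alpha>}}"
    then have i: "i \<in> ?I" "inj_on i {1..\<alpha>}" by auto
    then have i': "i \<in> {1..\<alpha>} \<rightarrow> {1..N}" by (simp add: PiE_def)
    have "rat_subst (?u i) ?Q = rat_subst (\<lambda>k. X (i k)) P"
      by (rule rat_subst_inverse[OF i' i(2) assms]) simp
    then show "rat_subst (?u i) ?Q * ?c i * delta_term N \<alpha> (seq_index N \<alpha> i) (\<lambda>_. 0) f =
        injection_term N \<alpha> P f i"
      unfolding c[OF i(1)] using i by (simp add: injection_term_def delta_term_seq_index)
  next
    show "\<forall>i\<in>?I - {i. i \<in> ?I \<and> inj_on i {1..\<alpha>}}.
        rat_subst (?u i) ?Q * ?c i * delta_term N \<alpha> (seq_index N \<alpha> i) (\<lambda>_. 0) f = 0"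
    proof
      fix i assume "i \<in> ?I - {i. i \<in> ?I \<and> inj_on i {1..\<alpha>}}"
      \<comment> \<open>P may fail to be regular at a sequence with repetitions, leaving its value
        unspecified; the zero from the kernel removes the term all the same.\<close>
      then have "?c i = 0" using c[of i] by auto
      then show "rat_subst (?u i) ?Q * ?c i * delta_term N \<alpha> (seq_index N \<alpha> i) (\<lambda>_. 0) f = 0"
        by simp
    qed
  qed (auto intro: finite_PiE)
  finally show ?thesis by (simp add: M_op_def)
qed

lemma D_op_eq_sum_injections:
  assumes "\<alpha> \<le> N" "P \<in> sym_ratfuns \<alpha>"
  shows "D_op N \<alpha> P f = 1 / of_nat (fact \<alpha>) *
    (\<Sum>i | i \<in> {1..\<alpha>} \<rightarrow>\<^sub>E {1..N} \<and> inj_on i {1..\<alpha>}. injection_term N \<alpha> P f i)"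
proof -
  have "rat_subst (\<lambda>i. X (\<sigma> i)) P *
      (\<Prod>i\<in>{1..\<alpha>}. \<Prod>j\<in>{\<alpha><..N}. (tt * X (\<sigma> i) - X (\<sigma> j)) / (X (\<sigma> i) - X (\<sigma> j))) *
      op_prod \<alpha> (\<lambda>k. shift (\<sigma> k)) f = injection_term N \<alpha> P f (restrict \<sigma> {1..\<alpha>})"
    if \<sigma>: "\<sigma> permutes {1..N}" for \<sigma>
  proof -
    let ?i = "restrict \<sigma> {1..\<alpha>}"
    have inj: "inj \<sigma>" using \<sigma> by (rule permutes_inj)
    have "rat_subst (\<lambda>k. X (\<sigma> k)) P = rat_subst (\<lambda>k. X (?i k)) P"
      by (rule rat_subst_inj_cong[OF assms(2), symmetric]) (auto intro: inj_on_subset[OF inj])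
    moreover have "occ \<sigma> \<alpha> = occ ?i \<alpha>" by (rule occ_cong) simp
    moreover have "(\<Prod>j\<in>{\<alpha><..N}. (tt * X (\<sigma> k) - X (\<sigma> j)) / (X (\<sigma> k) - X (\<sigma> j))) =
        (\<Prod>j\<in>{1..N} - ?i ` {1..\<alpha>}. (tt * X (?i k) - X j) / (X (?i k) - X j))"
      if k: "k \<in> {1..\<alpha>}" for k
    proof -
      \<comment> \<open>The permutation carries the positions beyond \<alpha> bijectively to the
        indices outside the sequence, which reindexes the product.\<close>
      have "{\<alpha><..N} = {1..N} - {1..\<alpha>}" by auto
      then have "\<sigma> ` {\<alpha><..N} = {1..N} - ?i ` {1..\<alpha>}"
        using permutes_image[OF \<sigma>] by (simp add: image_set_diff[OF inj])
      moreover have "inj_on \<sigma> {\<alpha><..N}" using inj by (rule inj_on_subset) simp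
      ultimately have "bij_betw \<sigma> {\<alpha><..N} ({1..N} - ?i ` {1..\<alpha>})"
        by (simp add: bij_betw_def)
      from prod.reindex_bij_betw[OF this, of "\<lambda>j. (tt * X (?i k) - X j) / (X (?i k) - X j)"] k
      show ?thesis by simp
    qed
    ultimately show ?thesis
      by (simp add: injection_term_def op_prod_shift)
  qed
  then have D: "D_op N \<alpha> P f = 1 / (of_nat (fact \<alpha>) * of_nat (fact (N - \<alpha>))) *
      (\<Sum>\<sigma> | \<sigma> permutes {1..N}. injection_term N \<alpha> P f (restrict \<sigma> {1..\<alpha>}))"
    by (simp add: D_op_def)
  show ?thesis
    unfolding D sum_permutes_restrict[OF assms(1)]
    using of_nat_ratfun_neq_0[of "fact (N - \<alpha>)"] by (simp del: of_nat_fact)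
qed

theorem theorem5p4:
  fixes N \<alpha> :: nat and P :: ratfun
  assumes "1 \<le> \<alpha>" and "\<alpha> \<le> N"
    and "P \<in> sym_ratfuns \<alpha>"
  shows "\<forall>f\<in>sym_ratfuns N. M_op N \<alpha> P f = D_op N \<alpha> P f"
  using assms by (simp add: M_op_eq_sum_injections D_op_eq_sum_injections)

end
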